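(* Let $I$ be a left ideal of $\mathbb{H}[x_1,\ldots,x_d]$. Then its radical $\sqrt{I}$ is equal to each of the following: (1) the set of all $f \in \mathbb{H}[x_1,\ldots,x_d]$ such that for every $b \in \mathbb{H}$ there exists $N \in \mathbb{N}_0$ satisfying $(bf)^N \in I+I(bf)+\ldots+I(bf)^N$; (2) the intersection of all completely prime left ideals of $\mathbb{H}[x_1,\ldots,x_d]$ that contain $I$; (3) the intersection of all prime left ideals of $\mathbb{H}[x_1,\ldots,x_d]$ that contain $I$; (4) the smallest semiprime left ideal of $\mathbb{H}[x_1,\ldots,x_d]$ that contains $I$.
   Context: $\mathbb{H}$ denotes the real quaternions and $\mathbb{H}[x_1,\ldots,x_d]$ is the ring of quaternionic polynomials in $d$ central variables (the variables commute with each other and with $\mathbb{H}$). For $f=\sum c_{i_1,\ldots,i_d}x_1^{i_1}\cdots x_d^{i_d}$ and $a=(a_1,\ldots,a_d)\in\mathbb{H}^d$ the value is $f(a)=\sum c_{i_1,\ldots,i_d}a_1^{i_1}\cdots a_d^{i_d}\in\mathbb{H}$. A point $a\in\mathbb{H}^d$ is central if $a_ia_j=a_ja_i$ for all $i,j$; $\mathbb{H}_c^d$ is the set of central points. For a left ideal $I$ of $\mathbb{H}[x_1,\ldots,x_d]$, let $\mathcal{Z}(I)$ be the set of all $a\in\mathbb{H}_c^d$ with $g(a)=0$ for all $g\in I$. The radical $\sqrt{I}$ is the set of all $f\in\mathbb{H}[x_1,\ldots,x_d]$ with $f(a)=0$ for every $a\in\mathcal{Z}(I)$ (it is a left ideal).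 For a left ideal $I$ of an associative unital ring $A$: $I$ is prime if for all $a,b\in A$ with $aAb\subseteq I$ we have $a\in I$ or $b\in I$; $I$ is semiprime if for every $a\in A$ with $aAa\subseteq I$ we have $a\in I$; $I$ is completely prime if for all $a,b\in A$ with $ab\in I$ and $Ib\subseteq I$ we have $a\in I$ or $b\in I$. For $f\in A$, $If^k=\{gf^k\mid g\in I\}$. *)

theory Defs
  imports Complex_Main "HOL-Library.Poly_Mapping" "HOL-Library.Set_Algebras"
begin

section \<open>Real quaternions\<close>

codatatype quat = Quat (q1: real) (qi: real) (qj: real) (qk: real)

lemma quat_eq_iff: "x = y \<longleftrightarrow> q1 x = q1 y \<and> qi x = qi y \<and> qj x = qj y \<and> qk x = qk y"
  by (auto intro: quat.expand)

instantiation quat :: ab_group_add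
begin

primcorec zero_quat where
  "q1 0 = 0" | "qi 0 = 0" | "qj 0 = 0" | "qk 0 = 0"

primcorec plus_quat where
  "q1 (x + y) = q1 x + q1 y"
| "qi (x + y) = qi x + qi y"
| "qj (x + y) = qj x + qj y"
| "qk (x + y) = qk x + qk y"

primcorec uminus_quat where
  "q1 (- x) = - q1 x"
| "qi (- x) = - qi x"
| "qj (- x) = - qj x"
| "qk (- x) = - qk x"

primcorec minus_quat where
  "q1 (x - y) = q1 x - q1 y"
| "qi (x - y) = qi x - qi y"
| "qj (x - y) = qj x - qj y"
| "qk (x - y) = qk x - qk y"

instance
  by standard (simp_all add: quat_eq_iff)

end

instantiation quat :: division_ring
begin

primcorec one_quat where
  "q1 1 = 1" | "qi 1 = 0" | "qj 1 = 0" | "qk 1 = 0"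

primcorec times_quat where
  "q1 (x * y) = q1 x * q1 y - qi x * qi y - qj x * qj y - qk x * qk y"
| "qi (x * y) = q1 x * qi y + qi x * q1 y + qj x * qk y - qk x * qj y"
| "qj (x * y) = q1 x * qj y - qi x * qk y + qj x * q1 y + qk x * qi y"
| "qk (x * y) = q1 x * qk y + qi x * qj y - qj x * qi y + qk x * q1 y"

primcorec inverse_quat where
  "q1 (inverse x) = q1 x / ((q1 x)\<^sup>2 + (qi x)\<^sup>2 + (qj x)\<^sup>2 + (qk x)\<^sup>2)"
| "qi (inverse x) = - qi x / ((q1 x)\<^sup>2 + (qi x)\<^sup>2 + (qj x)\<^sup>2 + (qk x)\<^sup>2)"
| "qj (inverse x) = - qj x / ((q1 x)\<^sup>2 + (qi x)\<^sup>2 + (qj x)\<^sup>2 + (qk x)\<^sup>2)"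
| "qk (inverse x) = - qk x / ((q1 x)\<^sup>2 + (qi x)\<^sup>2 + (qj x)\<^sup>2 + (qk x)\<^sup>2)"

definition "x div y = x * inverse y" for x y :: quat

instance
proof
  fix x y z :: quat
  show "x * y * z = x * (y * z)"
    by (simp add: quat_eq_iff algebra_simps)
  show "(x + y) * z = x * z + y * z" "x * (y + z) = x * y + x * z"
    by (simp_all add: quat_eq_iff algebra_simps)
  show "1 * x = x" "x * 1 = x" "(0::quat) \<noteq> 1" "inverse (0::quat) = 0"
    by (simp_all add: quat_eq_iff)
  show "x div y = x * inverse y"
    by (simp add: divide_quat_def)
  assume "x \<noteq> 0"
  define n where "n = (q1 x)\<^sup>2 + (qi x)\<^sup>2 + (qj x)\<^sup>2 + (qk x)\<^sup>2"
  from \<open>x \<noteq> 0\<close> have "n \<noteq> 0"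
    unfolding n_def by (auto simp: quat_eq_iff add_nonneg_eq_0_iff)
  moreover have "q1 x * q1 x + qi x * qi x + qj x * qj x + qk x * qk x = n"
    by (simp add: n_def power2_eq_square)
  ultimately show "inverse x * x = 1" "x * inverse x = 1"
    unfolding quat_eq_iff times_quat.sel one_quat.sel inverse_quat.sel n_def[symmetric]
    by (simp_all add: field_simps)
qed

end

section \<open>Quaternionic polynomials in central variables\<close>

text \<open>
  The variables are indexed by a finite linearly ordered type \<open>'d\<close>; its order plays the role of
  \<open>1 < \<dots> < d\<close>. A polynomial is a finitely supported map from exponent vectors to
  coefficients with the convolution product of the library, in which the variables commute with
  each other and with all constants.
\<close>

type_synonym 'd qpoly = "('d \<Rightarrow>\<^sub>0 nat) \<Rightarrow>\<^sub>0 quat"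

definition qconst :: "quat \<Rightarrow> 'd qpoly" where
  "qconst b = Poly_Mapping.single 0 b"

text \<open>
  Coefficients stand to the left, and the powers of the \<open>a i\<close> are multiplied from left to right in
  the order of the variables; this matters only at points that are not central.
\<close>

definition qeval :: "'d::{finite,linorder} qpoly \<Rightarrow> ('d \<Rightarrow> quat) \<Rightarrow> quat" where
  "qeval f a = (\<Sum>m\<in>Poly_Mapping.keys f. Poly_Mapping.lookup f m *
     prod_list (map (\<lambda>i. a i ^ Poly_Mapping.lookup m i) (sorted_list_of_set UNIV)))"

definition central_points :: "('d \<Rightarrow> quat) set" where
  "central_points = {a. \<forall>i j. a i * a j = a j * a i}"

definition zero_locus :: "'d::{finite,linorder} qpoly set \<Rightarrow> ('d \<Rightarrow> quat) set" where
  "zero_locus I = {a \<in> central_points. \<forall>g\<in>I. qeval g a = 0}"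

definition qradical :: "'d::{finite,linorder} qpoly set \<Rightarrow> 'd qpoly set" where
  "qradical I = {f. \<forall>a\<in>zero_locus I. qeval f a = 0}"

section \<open>Left ideals\<close>

definition left_ideal :: "'a::ring_1 set \<Rightarrow> bool" where
  "left_ideal I \<longleftrightarrow> 0 \<in> I \<and> (\<forall>x\<in>I. \<forall>y\<in>I. x + y \<in> I) \<and> (\<forall>r. \<forall>x\<in>I. r * x \<in> I)"

text \<open>None of the following three notions requires the left ideal to be proper.\<close>

definition prime_left_ideal :: "'a::ring_1 set \<Rightarrow> bool" where
  "prime_left_ideal I \<longleftrightarrow> left_ideal I \<and>
     (\<forall>a b. {a * r * b | r. True} \<subseteq> I \<longrightarrow> a \<in> I \<or> b \<in> I)"

definition semiprime_left_ideal :: "'a::ring_1 set \<Rightarrow> bool" where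
  "semiprime_left_ideal I \<longleftrightarrow> left_ideal I \<and>
     (\<forall>a. {a * r * a | r. True} \<subseteq> I \<longrightarrow> a \<in> I)"

definition completely_prime_left_ideal :: "'a::ring_1 set \<Rightarrow> bool" where
  "completely_prime_left_ideal I \<longleftrightarrow> left_ideal I \<and>
     (\<forall>a b. a * b \<in> I \<and> {g * b | g. g \<in> I} \<subseteq> I \<longrightarrow> a \<in> I \<or> b \<in> I)"

text \<open>
  Sums of sets are elementwise (\<open>Set_Algebras\<close>), so \<open>\<Sum>k\<le>N. right_mult_power I f k\<close> is
  \<open>I + I f + \<dots> + I f\<^sup>N\<close>.
\<close>

definition right_mult_power :: "'a::ring_1 set \<Rightarrow> 'a \<Rightarrow> nat \<Rightarrow> 'a set" where
  "right_mult_power I f k = {g * f ^ k | g. g \<in> I}"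

end

theory Submission
  imports Defs "HOL-Computational_Algebra.Fundamental_Theorem_Algebra"
    "HOL-Analysis.Continuum_Not_Denumerable"
begin

text \<open>
  At a central point \<open>a\<close>, the value of \<open>f * h\<close> is determined by \<open>f\<close> and the value of \<open>h\<close>, and it is
  \<open>0\<close> if the latter is. The polynomials vanishing at \<open>a\<close> therefore form a left ideal with quotient
  the quaternions, hence a maximal left ideal, and maximal left ideals are both prime and completely
  prime (\<open>maximal_imp_prime\<close>, \<open>maximal_imp_completely_prime\<close>). The radical is the intersection of the
  ideals of this kind that contain \<open>I\<close>. So it is semiprime and contains the intersections of all
  prime, and of all completely prime, left ideals above \<open>I\<close>. Since prime and completely prime left
  ideals are semiprime, what remains is to place the radical inside every semiprime left ideal above
  \<open>I\<close>, and to establish the description by powers.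

  The description by powers comes from a Nullstellensatz and the Rabinowitsch trick. In a ring
  generated by quaternions and finitely many central elements, every maximal left ideal \<open>M\<close> contains
  elements \<open>X i - a i\<close> for some pairwise commuting quaternions \<open>a i\<close> (\<open>residue_point\<close>). The proof
  counts dimensions: such a ring has countable dimension over the uncountable field of real numbers,
  so each \<open>X i\<close> satisfies a real polynomial modulo \<open>M\<close>, and by factorisation a quadratic one; then
  all \<open>X i\<close> reduce to real numbers, or to real combinations of \<open>1\<close> and a single \<open>p\<close> with
  \<open>p * p = - 1\<close>, which in turn reduces to a quaternion. With one more variable \<open>y\<close> this shows
  that \<open>I\<close> and \<open>1 - y f\<close> generate the unit left ideal whenever \<open>f\<close> is in the radical, and
  substituting \<open>1 / f\<close> for \<open>y\<close> on the right gives
  \<open>f\<^sup>N \<in> I + I f + \<dots> + I f\<^sup>N\<close> (\<open>radical_power_relation\<close>). Conversely, if \<open>f\<close> does not vanish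
  at a zero \<open>a\<close> of \<open>I\<close>, choose \<open>b\<close> such that \<open>h = b f\<close> takes the value \<open>1\<close> at \<open>a\<close>; right
  multiplication by \<open>h\<close> does not change values at \<open>a\<close>, so \<open>h\<^sup>N\<close> has value \<open>1\<close> while all of
  \<open>I + I h + \<dots> + I h\<^sup>N\<close> vanishes there.

  That the radical lies in each semiprime \<open>J\<close> above \<open>I\<close> is deduced from these power relations, for \<open>J\<close>
  in place of \<open>I\<close>, by means of the quaternionic conjugation (\<open>semiprime_contains_power_related\<close>).
  Write \<open>h\<^sup>*\<close> for the conjugate of \<open>h\<close>. If \<open>J h \<subseteq> J\<close>, the power relation says that a power of \<open>h\<close>
  lies in \<open>J\<close>, and since \<open>h\<close> satisfies a quadratic equation with central coefficients, semiprimeness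
  then gives \<open>tr(h) h \<in> J\<close>. The condition \<open>J h \<subseteq> J\<close> is not automatic, but \<open>J J\<^sup>*\<close> lies in a
  two-sided ideal inside \<open>J\<close>, because the polar form of the norm maps pairs from \<open>J\<close> into \<open>J\<close>. So
  the condition holds for \<open>h = u\<^sup>* x f\<close> with \<open>u \<in> J\<close>; from this it follows for \<open>h = x f\<close>, and then
  \<open>f x f \<in> J\<close> for all \<open>x\<close>.
\<close>

section \<open>Left ideals\<close>

lemma left_ideal_0: "left_ideal J \<Longrightarrow> 0 \<in> J"
  and left_ideal_add: "left_ideal J \<Longrightarrow> x \<in> J \<Longrightarrow> y \<in> J \<Longrightarrow> x + y \<in> J"
  and left_ideal_mult: "left_ideal J \<Longrightarrow> x \<in> J \<Longrightarrow> r * x \<in> J"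
  by (auto simp: left_ideal_def)

lemma left_ideal_minus: "left_ideal J \<Longrightarrow> x \<in> J \<Longrightarrow> - x \<in> J"
  using left_ideal_mult[of J x "-1"] by simp

lemma left_ideal_diff: "left_ideal J \<Longrightarrow> x \<in> J \<Longrightarrow> y \<in> J \<Longrightarrow> x - y \<in> J"
  using left_ideal_add[of J x "- y"] left_ideal_minus[of J y] by simp

lemma left_ideal_sum: "left_ideal J \<Longrightarrow> (\<And>k. k \<in> K \<Longrightarrow> f k \<in> J) \<Longrightarrow> sum f K \<in> J"
  by (induction K rule: infinite_finite_induct) (auto simp: left_ideal_0 left_ideal_add)

lemma left_ideal_diff_cancel:
  assumes "left_ideal J" "x - y \<in> J" shows "x \<in> J \<longleftrightarrow> y \<in> J"
  using left_ideal_add[OF assms(1) assms(2), of y] left_ideal_diff[OF assms(1) _ assms(2), of x]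
  by auto

definition central :: "'a::ring_1 \<Rightarrow> bool" where
  "central z \<longleftrightarrow> (\<forall>b. z * b = b * z)"

lemma centralD: "central z \<Longrightarrow> z * b = b * z"
  by (simp add: central_def)

lemma central_left_commute: "central z \<Longrightarrow> b * (z * c) = z * (b * c)"
  by (metis centralD mult.assoc)

lemma central_add: "central z \<Longrightarrow> central w \<Longrightarrow> central (z + w)"
  by (simp add: central_def algebra_simps)

lemma central_diff: "central z \<Longrightarrow> central w \<Longrightarrow> central (z - w)"
  by (simp add: central_def algebra_simps)

lemma central_mult: "central z \<Longrightarrow> central w \<Longrightarrow> central (z * w)"
  by (metis central_def mult.assoc)

lemma central_power: "central z \<Longrightarrow> central (z ^ k)"
  by (induction k) (auto intro: central_mult simp: central_def[of 1])

text \<open>The largest two-sided ideal inside \<open>J\<close>, that is, the annihilator of the module \<open>A / J\<close>.\<close>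

definition core :: "'a::ring_1 set \<Rightarrow> 'a set" where
  "core J = {b. \<forall>r. b * r \<in> J}"

lemma core_subset: "b \<in> core J \<Longrightarrow> b \<in> J"
  unfolding core_def by (metis mem_Collect_eq mult.right_neutral)

lemma left_ideal_core: "left_ideal J \<Longrightarrow> left_ideal (core J)"
  by (auto simp: left_ideal_def core_def distrib_right mult.assoc)

lemma core_mult_right: "b \<in> core J \<Longrightarrow> b * r \<in> core J"
  by (auto simp: core_def mult.assoc)

lemma central_in_core: "left_ideal J \<Longrightarrow> central z \<Longrightarrow> z \<in> J \<Longrightarrow> z \<in> core J"
  by (auto simp: core_def centralD left_ideal_mult)

definition maximal_left_ideal :: "'a::ring_1 set \<Rightarrow> bool" where
  "maximal_left_ideal M \<longleftrightarrow> left_ideal M \<and> 1 \<notin> M \<and>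
     (\<forall>J. left_ideal J \<and> M \<subseteq> J \<and> 1 \<notin> J \<longrightarrow> J = M)"

lemma maximal_left_ideal_left_ideal: "maximal_left_ideal M \<Longrightarrow> left_ideal M"
  by (simp add: maximal_left_ideal_def)

lemma ex_maximal_left_ideal:
  assumes "left_ideal J" "1 \<notin> J"
  shows "\<exists>M. maximal_left_ideal M \<and> J \<subseteq> M"
proof -
  define P where "P = {L. left_ideal L \<and> J \<subseteq> L \<and> 1 \<notin> L}"
  have "\<exists>M\<in>P. \<forall>L\<in>P. M \<subseteq> L \<longrightarrow> L = M"
  proof (rule subset_Zorn_nonempty)
    show "P \<noteq> {}" using assms by (auto simp: P_def)
    fix \<C> assume ne: "\<C> \<noteq> {}" and ch: "subset.chain P \<C>"
    then have sub: "\<C> \<subseteq> P" by (auto simp: subset.chain_def)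
    have "left_ideal (\<Union>\<C>)"
      unfolding left_ideal_def
    proof (intro conjI ballI allI)
      show "0 \<in> \<Union>\<C>" using ne sub by (auto simp: P_def left_ideal_def)
      show "r * x \<in> \<Union>\<C>" if "x \<in> \<Union>\<C>" for r x
        using that sub left_ideal_mult unfolding P_def by blast
      show "x + y \<in> \<Union>\<C>" if xy: "x \<in> \<Union>\<C>" "y \<in> \<Union>\<C>" for x y
      proof -
        from xy obtain K L where KL: "K \<in> \<C>" "L \<in> \<C>" "x \<in> K" "y \<in> L" by blast
        then consider "K \<subseteq> L" | "L \<subseteq> K" using ch by (auto simp: subset.chain_def)
        then show ?thesis
        proof cases
          case 1
          then have "x + y \<in> L" using KL sub by (intro left_ideal_add) (auto simp: P_def)
          then show ?thesis using KL by blast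
        next
          case 2
          then have "x + y \<in> K" using KL sub by (intro left_ideal_add) (auto simp: P_def)
          then show ?thesis using KL by blast
        qed
      qed
    qed
    then show "\<Union>\<C> \<in> P" using sub ne by (auto simp: P_def)
  qed
  then obtain M where M: "M \<in> P" "\<And>L. L \<in> P \<Longrightarrow> M \<subseteq> L \<Longrightarrow> L = M" by blast
  have "L = M" if "left_ideal L" "M \<subseteq> L" "1 \<notin> L" for L
    using that M(1) by (intro M(2)) (auto simp: P_def)
  then have "maximal_left_ideal M" using M(1) by (simp add: P_def maximal_left_ideal_def)
  then show ?thesis using M(1) by (auto simp: P_def)
qed

lemma maximal_left_ideal_inverse:
  assumes M: "maximal_left_ideal M" and b: "b \<notin> M"
  shows "\<exists>r. 1 - r * b \<in> M"
proof (rule ccontr)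
  assume neg: "\<not> ?thesis"
  define L where "L = {m + r * b | m r. m \<in> M}"
  have MI: "left_ideal M" using M by (simp add: maximal_left_ideal_def)
  have "left_ideal L"
    unfolding left_ideal_def
  proof (intro conjI ballI allI)
    have "0 = 0 + 0 * b" by simp
    then show "0 \<in> L" unfolding L_def using left_ideal_0[OF MI] by blast
    show "x + y \<in> L" if "x \<in> L" "y \<in> L" for x y
    proof -
      from that obtain m r n s where "x = m + r * b" "m \<in> M" "y = n + s * b" "n \<in> M"
        unfolding L_def by blast
      then have "x + y = (m + n) + (r + s) * b" "m + n \<in> M"
        using left_ideal_add[OF MI] by (auto simp: algebra_simps)
      then show ?thesis unfolding L_def by blast
    qed
    show "t * x \<in> L" if "x \<in> L" for x t
    proof -
      from that obtain m r where "x = m + r * b" "m \<in> M" unfolding L_def by blast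
      then have "t * x = t * m + (t * r) * b" "t * m \<in> M"
        using left_ideal_mult[OF MI] by (auto simp: algebra_simps)
      then show ?thesis unfolding L_def by blast
    qed
  qed
  moreover have "M \<subseteq> L"
  proof
    fix m assume "m \<in> M"
    moreover have "m = m + 0 * b" by simp
    ultimately show "m \<in> L" unfolding L_def by blast
  qed
  moreover have "1 \<notin> L"
  proof
    assume "1 \<in> L"
    then obtain m r where "1 = m + r * b" "m \<in> M" unfolding L_def by blast
    then have "1 - r * b \<in> M" by (metis add_diff_cancel_right')
    with neg show False by blast
  qed
  ultimately have "L = M" using M by (auto simp: maximal_left_ideal_def)
  moreover have "0 + 1 * b \<in> L" unfolding L_def using left_ideal_0[OF MI] by blast
  ultimately show False using b by simp
qed

text \<open>As \<open>b\<close> generates the quotient by \<open>M\<close>, write \<open>1 = r b + m\<close>; then \<open>a = a r b + a m\<close>.\<close>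

lemma maximal_imp_prime:
  assumes M: "maximal_left_ideal M" shows "prime_left_ideal M"
  unfolding prime_left_ideal_def
proof (intro conjI allI impI)
  have MI: "left_ideal M" using M by (simp add: maximal_left_ideal_def)
  then show "left_ideal M" .
  fix a b assume ab: "{a * r * b | r. True} \<subseteq> M"
  show "a \<in> M \<or> b \<in> M"
  proof (rule disjCI)
    assume "b \<notin> M"
    then obtain r where "1 - r * b \<in> M" using maximal_left_ideal_inverse[OF M] by blast
    then have "a * (1 - r * b) + a * r * b \<in> M"
      using ab by (blast intro: left_ideal_add[OF MI] left_ideal_mult[OF MI])
    then show "a \<in> M" by (simp add: algebra_simps)
  qed
qed

text \<open>Right multiplication by \<open>b\<close> induces an endomorphism of the simple module \<open>A / M\<close>, which is zero
  or injective.\<close>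

lemma maximal_imp_completely_prime:
  assumes M: "maximal_left_ideal M" shows "completely_prime_left_ideal M"
  unfolding completely_prime_left_ideal_def
proof (intro conjI allI impI)
  have MI: "left_ideal M" using M by (simp add: maximal_left_ideal_def)
  then show "left_ideal M" .
  fix a b assume ab: "a * b \<in> M \<and> {g * b | g. g \<in> M} \<subseteq> M"
  show "a \<in> M \<or> b \<in> M"
  proof (rule disjCI)
    assume b: "b \<notin> M"
    define L where "L = {c. c * b \<in> M}"
    have "left_ideal L" using MI by (auto simp: left_ideal_def L_def distrib_right mult.assoc)
    moreover have "M \<subseteq> L" "1 \<notin> L" using ab b by (auto simp: L_def)
    ultimately have "L = M" using M by (auto simp: maximal_left_ideal_def)
    then show "a \<in> M" using ab by (auto simp: L_def)
  qed
qed

lemma maximal_central_mult: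
  assumes M: "maximal_left_ideal M" and "central t" "s * t \<in> M"
  shows "s \<in> M \<or> t \<in> M"
proof -
  have "left_ideal M" using M by (rule maximal_left_ideal_left_ideal)
  then have "{g * t | g. g \<in> M} \<subseteq> M"
    using \<open>central t\<close> by (auto simp: centralD[of t, symmetric] left_ideal_mult)
  then show ?thesis
    using maximal_imp_completely_prime[OF M] \<open>s * t \<in> M\<close>
    unfolding completely_prime_left_ideal_def by blast
qed

section \<open>Nullstellensatz\<close>

text \<open>A real root splits off a linear factor. If \<open>z\<close> is a complex root that is not real, the remainder of
  \<open>P\<close> modulo the real polynomial with roots \<open>z\<close> and its conjugate is a real polynomial of degree
  less than two that vanishes at \<open>z\<close>, and so it is zero.\<close>

lemma real_poly_factor:
  fixes P :: "real poly"
  assumes "degree P \<noteq> 0"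
  shows "\<exists>Q P' c d. P = Q * P' \<and> (Q = [:-c, 1:] \<or> Q = [:-c, 1:] * [:-c, 1:] + [:d^2:])"
proof -
  define val where "val z p = poly (map_poly complex_of_real p) z" for z p
  have val_pCons: "val z (pCons r p) = of_real r + z * val z p" for z r p
    by (simp add: val_def map_poly_pCons)
  have val_0: "val z 0 = 0" for z by (simp add: val_def)
  have val_add: "val z (p + q) = val z p + val z q" for z p q
    by (induction p q rule: poly_induct2) (simp_all add: val_pCons val_0 algebra_simps)
  have val_smult: "val z (smult r p) = of_real r * val z p" for z r p
    by (induction p) (simp_all add: val_pCons val_0 algebra_simps)
  have val_mult: "val z (p * q) = val z p * val z q" for z p q
    by (induction p) (simp_all add: val_pCons val_0 val_add val_smult algebra_simps)
  have val_real: "val (of_real r) p = of_real (poly p r)" for r p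
    by (induction p) (simp_all add: val_pCons val_0)
  have "degree (map_poly complex_of_real P) = degree P" by (rule degree_map_poly) simp
  then have "\<not> constant (poly (map_poly complex_of_real P))"
    using assms by (simp add: constant_degree)
  then obtain z where z: "val z P = 0"
    unfolding val_def using fundamental_theorem_of_algebra by blast
  show ?thesis
  proof (cases "Im z = 0")
    case True
    then have "z = of_real (Re z)" by (simp add: complex_eq_iff)
    then have "poly P (Re z) = 0" using z val_real[of "Re z" P] by simp
    then have "[:- Re z, 1:] dvd P" by (simp add: poly_eq_0_iff_dvd)
    then show ?thesis by (blast elim: dvdE)
  next
    case False
    define Q where "Q = [:- Re z, 1:] * [:- Re z, 1:] + [:(Im z)^2:]"
    have degQ: "degree Q = 2" by (simp add: Q_def)
    have Qz: "val z Q = 0"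
      by (simp add: Q_def val_add val_mult val_pCons val_0 complex_eq_iff power2_eq_square algebra_simps)
    have "val z (P mod Q) = 0"
      using z val_add[of z "P div Q * Q" "P mod Q"] by (simp add: val_mult Qz)
    moreover have "degree (P mod Q) < 2"
      using degree_mod_less[of Q P] degQ by force
    then obtain s t where st: "P mod Q = [:s, t:]"
      by (metis degree_pCons_eq degree_eq_zeroE less_2_cases pCons_cases pCons_0_0 nat.inject One_nat_def)
    ultimately have "of_real s + z * of_real t = 0" by (simp add: val_pCons val_0)
    then have "t = 0" "s = 0" using False by (auto simp: complex_eq_iff)
    then have "P = Q * (P div Q)" using st mult_div_mod_eq[of Q P] by simp
    then show ?thesis unfolding Q_def by blast
  qed
qed

text \<open>The Nullstellensatz is needed for the quaternionic polynomials with one further variable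
  adjoined. What its proof uses is collected here: \<open>C\<close> embeds the constants, \<open>X\<close> lists the
  variables. The last assumption is an induction principle which says that constants and variables
  generate the ring; it is available because a polynomial is a sum of constants multiplied from the
  left by variables.\<close>

locale quaternionic_generators =
  fixes C :: "quat \<Rightarrow> 'a::ring_1" and X :: "'v::finite \<Rightarrow> 'a"
  assumes C_1: "C 1 = 1"
    and C_add: "C (p + q) = C p + C q"
    and C_mult: "C (p * q) = C p * C q"
    and X_central: "central (X i)"
    and generated: "(\<And>q. P (C q)) \<Longrightarrow> (\<And>a b. P a \<Longrightarrow> P b \<Longrightarrow> P (a + b)) \<Longrightarrow>
      (\<And>i a. P a \<Longrightarrow> P (X i * a)) \<Longrightarrow> P a"
begin

definition R :: "real \<Rightarrow> 'a" where
  "R r = C (Quat r 0 0 0)"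

lemma C_0: "C 0 = 0"
  using C_add[of 0 0] by simp

lemma C_minus: "C (- q) = - C q"
  using C_add[of q "- q"] C_0 by (simp add: add_eq_0_iff)

lemma C_diff: "C (p - q) = C p - C q"
  using C_add[of p "- q"] C_minus by simp

lemma R_0 [simp]: "R 0 = 0" and R_1 [simp]: "R 1 = 1"
proof -
  have "Quat 0 0 0 0 = 0" "Quat 1 0 0 0 = 1" by (simp_all add: quat_eq_iff)
  then show "R 0 = 0" "R 1 = 1" by (simp_all add: R_def C_0 C_1)
qed

lemma R_add: "R (r + s) = R r + R s"
proof -
  have "Quat (r + s) 0 0 0 = Quat r 0 0 0 + Quat s 0 0 0" by (simp add: quat_eq_iff)
  then show ?thesis by (simp add: R_def C_add)
qed

lemma R_mult: "R (r * s) = R r * R s"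
proof -
  have "Quat (r * s) 0 0 0 = Quat r 0 0 0 * Quat s 0 0 0" by (simp add: quat_eq_iff)
  then show ?thesis by (simp add: R_def C_mult)
qed

lemma R_minus: "R (- r) = - R r"
  using R_add[of r "- r"] by (simp add: add_eq_0_iff)

lemma R_diff: "R (r - s) = R r - R s"
  using R_add[of r "- s"] R_minus by simp

lemma R_central: "central (R r)"
  unfolding central_def
proof
  fix b
  show "R r * b = b * R r"
  proof (induction b rule: generated)
    case (1 q)
    have "Quat r 0 0 0 * q = q * Quat r 0 0 0" by (simp add: quat_eq_iff)
    then show ?case by (simp add: R_def C_mult[symmetric])
  next
    case (2 a b)
    then show ?case by (simp add: algebra_simps)
  next
    case (3 i a)
    then show ?case using X_central[of i] by (metis centralD mult.assoc)
  qed
qed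

lemma const_in_proper:
  assumes "left_ideal M" "1 \<notin> M" "C q \<in> M" shows "q = 0"
proof (rule ccontr)
  assume "q \<noteq> 0"
  then have "C (inverse q) * C q = 1" by (simp add: C_mult[symmetric] C_1)
  then show False using assms left_ideal_mult by metis
qed

subsection \<open>Real polynomials in a central element\<close>

definition ev :: "'a \<Rightarrow> real poly \<Rightarrow> 'a" where
  "ev x p = fold_coeffs (\<lambda>r b. R r + x * b) p 0"

lemma ev_0 [simp]: "ev x 0 = 0"
  by (simp add: ev_def)

lemma ev_pCons [simp]: "ev x (pCons r p) = R r + x * ev x p"
  by (cases "p = 0 \<and> r = 0") (auto simp: ev_def)

lemma ev_add: "ev x (p + q) = ev x p + ev x q"
  by (induction p q rule: poly_induct2) (simp_all add: R_add algebra_simps)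

lemma ev_smult: "ev x (smult r p) = R r * ev x p"
  by (induction p) (simp_all add: R_mult distrib_left central_left_commute[OF R_central])

lemma ev_central: "central x \<Longrightarrow> central (ev x p)"
  by (induction p) (auto intro!: central_add central_mult R_central simp: central_def[of 0])

lemma ev_mult: "ev x (p * q) = ev x p * ev x q"
  by (induction p) (simp_all add: ev_add ev_smult algebra_simps)

lemma ev_sum: "ev x (sum f K) = (\<Sum>k\<in>K. ev x (f k))"
  by (induction K rule: infinite_finite_induct) (simp_all add: ev_add)

text \<open>Over the reals the ring is spanned by the words in the variables, each multiplied by one of the
  four quaternion units.\<close>

lemma countably_spanned:
  "\<exists>E. countable E \<and> module.span (\<lambda>r b. R r * b) E = UNIV"
proof -
  interpret V: vector_space "\<lambda>r b. R r * b"
    by standard (simp_all add: R_add R_mult algebra_simps)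
  define word where "word ws = foldr (\<lambda>i b. X i * b) ws" for ws
  define U where "U = {Quat 1 0 0 0, Quat 0 1 0 0, Quat 0 0 1 0, Quat 0 0 0 1}"
  define E where "E = (\<lambda>(ws, u). word ws (C u)) ` (lists UNIV \<times> U)"
  have "countable E"
    unfolding E_def U_def
    by (intro countable_image countable_SIGMA countable_lists) (auto intro: countable_finite)
  moreover have "b \<in> V.span E" for b
  proof (induction b rule: generated)
    case (1 q)
    have CU: "C u \<in> V.span E" if "u \<in> U" for u
      using that by (intro V.span_base) (force simp: E_def word_def intro: image_eqI[of _ _ "([], u)"])
    have "q = Quat (q1 q) 0 0 0 * Quat 1 0 0 0 + Quat (qi q) 0 0 0 * Quat 0 1 0 0
        + Quat (qj q) 0 0 0 * Quat 0 0 1 0 + Quat (qk q) 0 0 0 * Quat 0 0 0 1"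
      by (simp add: quat_eq_iff)
    then have "C q = R (q1 q) * C (Quat 1 0 0 0) + R (qi q) * C (Quat 0 1 0 0)
        + R (qj q) * C (Quat 0 0 1 0) + R (qk q) * C (Quat 0 0 0 1)"
      unfolding R_def by (metis C_add C_mult)
    then show ?case by (auto simp: U_def intro!: V.span_add V.span_scale CU)
  next
    case (2 a b)
    then show ?case by (rule V.span_add)
  next
    case (3 i a)
    then show ?case
    proof (induction rule: V.span_induct_alt)
      case base
      then show ?case by (simp add: V.span_zero)
    next
      case (step c x y)
      then obtain ws u where wu: "x = word ws (C u)" "u \<in> U" by (auto simp: E_def)
      then have "X i * x = word (i # ws) (C u)" by (simp add: word_def)
      then have "X i * x \<in> E" using wu by (force simp: E_def intro: image_eqI[of _ _ "(i # ws, u)"])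
      then have "R c * (X i * x) + X i * y \<in> V.span E"
        by (intro V.span_add V.span_scale V.span_base step)
      then show ?case by (simp add: distrib_left central_left_commute[OF R_central])
    qed
  qed
  ultimately show ?thesis by blast
qed

text \<open>If \<open>x - c\<close> is outside \<open>M\<close> for every real \<open>c\<close>, it has a left inverse \<open>u c\<close> modulo \<open>M\<close>. There are
  uncountably many such \<open>u c\<close> and the dimension is countable, so some of them satisfy a linear
  relation. Multiplying it by the product of the \<open>x - c\<close> involved turns it into a polynomial
  relation for \<open>x\<close> modulo \<open>M\<close>, as in the partial fraction argument that the functions
  \<open>1 / (x - c)\<close> are linearly independent.\<close>

lemma real_poly_in_maximal:
  assumes M: "maximal_left_ideal M" and x: "central x"
  shows "\<exists>P. P \<noteq> 0 \<and> ev x P \<in> M"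
proof (rule ccontr)
  assume neg: "\<not> ?thesis"
  interpret V: vector_space "\<lambda>r b. R r * b"
    by standard (simp_all add: R_add R_mult algebra_simps)
  have MI: "left_ideal M" and 1: "1 \<notin> M" using M by (auto simp: maximal_left_ideal_def)
  have "x - R c \<notin> M" for c
    using neg[simplified, rule_format, of "[:-c, 1:]"] by (simp add: R_minus)
  then have "\<exists>u. 1 - u * (x - R c) \<in> M" for c using maximal_left_ideal_inverse[OF M] by blast
  then obtain u where u: "\<And>c. 1 - u c * (x - R c) \<in> M" by metis
  \<comment> \<open>The resolvent identity: equal inverses of x - c and x - c' would make \<open>u
      c\<close>, hence \<open>1\<close>, vanish modulo \<open>M\<close>.\<close>
  have inj: "inj u"
  proof (rule injI, rule ccontr)
    fix c c' assume eq: "u c = u c'" and ne: "c \<noteq> c'"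
    have "(1 - u c * (x - R c)) - (1 - u c' * (x - R c')) = R (c - c') * u c"
      using eq centralD[OF R_central, of "c - c'" "u c"] by (simp add: R_diff algebra_simps)
    then have "R (c - c') * u c \<in> M" using left_ideal_diff[OF MI u u] by metis
    then have "R (inverse (c - c')) * (R (c - c') * u c) \<in> M" by (rule left_ideal_mult[OF MI])
    then have uM: "u c \<in> M" using ne by (simp add: mult.assoc[symmetric] R_mult[symmetric])
    have "u c * (x - R c) = (x - R c) * u c" using centralD[OF central_diff[OF x R_central]] by metis
    then have "u c * (x - R c) \<in> M" using left_ideal_mult[OF MI uM] by metis
    then show False using left_ideal_add[OF MI u, of "u c * (x - R c)" c] 1 by simp
  qed
  obtain E where E: "countable E" "V.span E = UNIV" using countably_spanned by blast
  have fin: "\<exists>F. finite F \<and> F \<subseteq> E \<and> b \<in> V.span F" for b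
  proof -
    have "b \<in> V.span E" using E by simp
    then obtain t r where t: "finite t" "t \<subseteq> E" "b = (\<Sum>a\<in>t. R (r a) * a)"
      unfolding V.span_explicit by blast
    then have "b \<in> V.span t" by (auto intro: V.span_sum V.span_scale V.span_base)
    with t show ?thesis by blast
  qed
  define FF where "FF = {F. finite F \<and> F \<subseteq> E}"
  have "countable FF" unfolding FF_def using E(1) by (rule countable_Collect_finite_subset)
  \<comment> \<open>Only countably many finite subsets of \<open>E\<close> exist, so one of them has
      infinitely many \<open>u c\<close> in its span.\<close>
  have "\<exists>F\<in>FF. infinite {c. u c \<in> V.span F}"
  proof (rule ccontr)
    assume "\<not> ?thesis"
    then have "countable (\<Union>F\<in>FF. {c. u c \<in> V.span F})"
      using \<open>countable FF\<close> by (intro countable_UN) (auto intro: countable_finite)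
    moreover have "(\<Union>F\<in>FF. {c. u c \<in> V.span F}) = UNIV" using fin by (auto simp: FF_def)
    ultimately show False using uncountable_UNIV_real by simp
  qed
  then obtain F where F: "finite F" "infinite {c. u c \<in> V.span F}" by (auto simp: FF_def)
  have "V.dependent (u ` {c. u c \<in> V.span F})"
    using V.independent_span_bound[OF F(1), of "u ` {c. u c \<in> V.span F}"] F(2) inj
    by (auto simp: finite_image_iff inj_on_subset)
  then obtain t r where t: "finite t" "t \<subseteq> u ` {c. u c \<in> V.span F}"
      "(\<Sum>v\<in>t. R (r v) * v) = 0" "\<exists>v\<in>t. r v \<noteq> 0"
    unfolding V.dependent_explicit by (elim exE conjE)
  obtain D where D: "finite D" "t = u ` D" using finite_subset_image[OF t(1,2)] by blast
  define l where "l c = r (u c)" for c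
  have dep: "(\<Sum>c\<in>D. R (l c) * u c) = 0"
    using t(3) inj by (simp add: D(2) l_def sum.reindex inj_on_subset)
  obtain c0 where c0: "c0 \<in> D" "l c0 \<noteq> 0" using t(4) by (auto simp: D l_def)
  define Q where "Q c = (\<Prod>d\<in>D - {c}. [:-d, 1:])" for c
  define P where "P = (\<Sum>c\<in>D. smult (l c) (Q c))"
  \<comment> \<open>The value at \<open>c0\<close>, where only one summand survives, shows that
      \<open>P\<close> is not zero.\<close>
  have "poly P c0 = (\<Sum>c\<in>D. l c * poly (Q c) c0)" by (simp add: P_def poly_sum)
  also have "\<dots> = (\<Sum>c\<in>{c0}. l c * poly (Q c) c0)"
    using D(1) c0 by (intro sum.mono_neutral_right) (auto simp: Q_def poly_prod)
  finally have "poly P c0 \<noteq> 0" using c0 D(1) by (auto simp: Q_def poly_prod)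
  then have "P \<noteq> 0" by auto
  moreover have "ev x P \<in> M"
  proof -
    define T where "T = ev x (\<Prod>d\<in>D. [:-d, 1:])"
    have TQ: "T = ev x (Q c) * (x - R c)" if "c \<in> D" for c
    proof -
      have "(\<Prod>d\<in>D. [:-d, 1:]) = Q c * [:-c, 1:]"
        using D(1) that by (simp add: Q_def prod.remove[of D c] mult.commute)
      then have "T = ev x (Q c) * ev x [:-c, 1:]" unfolding T_def by (simp only: ev_mult)
      then show ?thesis by (simp add: R_minus)
    qed
    have "(\<Sum>c\<in>D. R (l c) * ev x (Q c) * (1 - u c * (x - R c))) \<in> M"
      by (intro left_ideal_sum[OF MI] left_ideal_mult[OF MI] u)
    also have "(\<Sum>c\<in>D. R (l c) * ev x (Q c) * (1 - u c * (x - R c))) =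
        (\<Sum>c\<in>D. R (l c) * ev x (Q c) - (R (l c) * u c) * T)"
    proof (rule sum.cong)
      fix c assume "c \<in> D"
      have "R (l c) * ev x (Q c) * (u c * (x - R c)) = R (l c) * u c * (ev x (Q c) * (x - R c))"
        by (metis centralD[OF ev_central[OF x]] mult.assoc)
      then show "R (l c) * ev x (Q c) * (1 - u c * (x - R c)) =
          R (l c) * ev x (Q c) - (R (l c) * u c) * T"
        using TQ[OF \<open>c \<in> D\<close>] by (simp add: right_diff_distrib)
    qed simp
    also have "\<dots> = ev x P"
      by (simp add: sum_subtractf P_def ev_sum ev_smult sum_distrib_right[symmetric] dep)
    finally show ?thesis .
  qed
  ultimately show False using neg by blast
qed

text \<open>A maximal left ideal is prime with respect to central elements, so it contains a factor of degree
  at most two of the polynomial just found. A linear factor is squared to give the uniform shape.\<close>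

lemma quadratic_in_maximal:
  assumes M: "maximal_left_ideal M" and x: "central x"
  shows "\<exists>c d. (x - R c)^2 + R (d^2) \<in> M"
proof -
  have MI: "left_ideal M" and 1: "1 \<notin> M" using M by (auto simp: maximal_left_ideal_def)
  have *: "\<exists>c d. (x - R c)^2 + R (d^2) \<in> M" if "P \<noteq> 0" "ev x P \<in> M" for P
    using that
  proof (induction "degree P" arbitrary: P rule: less_induct)
    case less
    have split: ?case if "P = Q * P'" "0 < degree Q" "ev x Q \<in> M \<Longrightarrow> ?case" for Q P'
    proof -
      have "ev x Q * ev x P' \<in> M" using less.prems that by (simp add: ev_mult)
      then consider "ev x Q \<in> M" | "ev x P' \<in> M"
        using maximal_central_mult[OF M ev_central[OF x]] by blast
      then show ?case
      proof cases
        case 2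
        have "P' \<noteq> 0" "Q \<noteq> 0" using less.prems that by auto
        then have "degree P' < degree P" using that by (simp add: degree_mult_eq)
        then show ?thesis using less.hyps 2 \<open>P' \<noteq> 0\<close> by blast
      qed (rule that)
    qed
    have "degree P \<noteq> 0"
    proof
      assume "degree P = 0"
      then obtain r where r: "P = [:r:]" using degree_eq_zeroE by blast
      then have "C (Quat r 0 0 0) \<in> M" using less.prems by (simp add: R_def)
      then have "Quat r 0 0 0 = 0" by (rule const_in_proper[OF MI 1])
      then show False using less.prems r by (simp add: quat_eq_iff)
    qed
    then obtain Q P' c d where P': "P = Q * P'"
      and Q: "Q = [:-c, 1:] \<or> Q = [:-c, 1:] * [:-c, 1:] + [:d^2:]"
      using real_poly_factor by blast
    show ?case
    proof (rule split[OF P'])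
      show "0 < degree Q" using Q by auto
      assume QM: "ev x Q \<in> M"
      from Q show ?case
      proof
        assume "Q = [:-c, 1:]"
        then have "x - R c \<in> M" using QM by (simp add: R_minus)
        then have "(x - R c)^2 + R (0^2) \<in> M"
          by (simp add: power2_eq_square left_ideal_mult[OF MI])
        then show ?thesis by blast
      next
        assume "Q = [:-c, 1:] * [:-c, 1:] + [:d^2:]"
        then have "ev x Q = ev x [:-c, 1:] * ev x [:-c, 1:] + ev x [:d^2:]"
          by (simp only: ev_add ev_mult)
        then have "ev x Q = (x - R c)^2 + R (d^2)" by (simp add: R_minus power2_eq_square)
        then show ?thesis using QM by metis
      qed
    qed
  qed
  then show ?thesis using real_poly_in_maximal[OF M x] by blast
qed

text \<open>Modulo the two-sided ideal \<open>core M\<close>, every element is of the form \<open>\<alpha> + \<beta> p\<close> with quaternions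
  \<open>\<alpha>\<close> and \<open>\<beta>\<close>. If \<open>M\<close> contains such an element other than \<open>0\<close>, it can be solved for \<open>p\<close>. Otherwise
  \<open>M = core M\<close> is two-sided, and this contradicts maximality: \<open>p - \<iota>\<close>, where \<open>\<iota>\<close> is a quaternion
  unit, would have a left inverse modulo \<open>M\<close> although \<open>(p - \<iota>) (p + \<iota>) = p p + 1\<close> is in \<open>M\<close>.\<close>

lemma imaginary_unit_residue:
  assumes M: "maximal_left_ideal M" and p: "central p" and pp: "p * p + 1 \<in> M"
    and X: "\<And>i. \<exists>c e. X i - R c - R e * p \<in> M"
  shows "\<exists>q. p - C q \<in> M"
proof -
  have MI: "left_ideal M" and 1: "1 \<notin> M" using M by (auto simp: maximal_left_ideal_def)
  note KI = left_ideal_core[OF MI]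
  have pK: "p * p + 1 \<in> core M"
    by (intro central_in_core[OF MI _ pp] central_add central_mult p) (simp add: central_def)
  have XK: "\<exists>c e. X i - R c - R e * p \<in> core M" for i
    using X[of i] by (meson central_in_core[OF MI] central_diff central_mult R_central X_central p)
  have res: "\<exists>\<alpha> \<beta>. b - (C \<alpha> + C \<beta> * p) \<in> core M" for b
  proof (induction b rule: generated)
    case (1 q)
    show ?case using left_ideal_0[OF KI] by (intro exI[of _ q] exI[of _ 0]) (simp add: C_0)
  next
    case (2 a b)
    then obtain \<alpha> \<beta> \<gamma> \<delta> where "a - (C \<alpha> + C \<beta> * p) \<in> core M" "b - (C \<gamma> + C \<delta> * p) \<in> core M"
      by blast
    then have "(a - (C \<alpha> + C \<beta> * p)) + (b - (C \<gamma> + C \<delta> * p)) \<in> core M"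
      by (rule left_ideal_add[OF KI])
    then show ?case
      by (intro exI[of _ "\<alpha> + \<gamma>"] exI[of _ "\<beta> + \<delta>"]) (simp add: C_add algebra_simps)
  next
    case (3 i a)
    then obtain \<alpha> \<beta> where ab: "a - (C \<alpha> + C \<beta> * p) \<in> core M" by blast
    obtain c e where ce: "X i - R c - R e * p \<in> core M" using XK by blast
    define c' e' where "c' = Quat c 0 0 0" and "e' = Quat e 0 0 0"
    have R: "R c = C c'" "R e = C e'" by (simp_all add: R_def c'_def e'_def)
    have "X i * (a - (C \<alpha> + C \<beta> * p)) + (X i - R c - R e * p) * (C \<alpha> + C \<beta> * p)
        + C (e' * \<beta>) * (p * p + 1) \<in> core M"
      by (intro left_ideal_add[OF KI] left_ideal_mult[OF KI] core_mult_right ab ce pK)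
    moreover have "p * C \<alpha> = C \<alpha> * p" "p * (C \<beta> * p) = C \<beta> * (p * p)"
      by (rule centralD[OF p], rule central_left_commute[OF p, symmetric])
    then have "X i * (a - (C \<alpha> + C \<beta> * p)) + (X i - R c - R e * p) * (C \<alpha> + C \<beta> * p)
        + C (e' * \<beta>) * (p * p + 1)
      = X i * a - (C (c' * \<alpha> - e' * \<beta>) + C (c' * \<beta> + e' * \<alpha>) * p)"
      by (simp add: R C_diff C_add C_mult algebra_simps)
    ultimately show ?case by metis
  qed
  show ?thesis
  proof (cases "\<exists>\<alpha> \<beta>. C \<alpha> + C \<beta> * p \<in> M \<and> (\<alpha> \<noteq> 0 \<or> \<beta> \<noteq> 0)")
    case True
    then obtain \<alpha> \<beta> where ab: "C \<alpha> + C \<beta> * p \<in> M" "\<alpha> \<noteq> 0 \<or> \<beta> \<noteq> 0" by blast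
    have "\<beta> \<noteq> 0"
    proof
      assume "\<beta> = 0"
      then have "C \<alpha> \<in> M" using ab by (simp add: C_0)
      then show False using const_in_proper[OF MI 1] ab \<open>\<beta> = 0\<close> by blast
    qed
    have "C (inverse \<beta>) * (C \<alpha> + C \<beta> * p) \<in> M" using ab by (intro left_ideal_mult[OF MI])
    moreover have "C (inverse \<beta>) * (C \<beta> * p) = p"
      using \<open>\<beta> \<noteq> 0\<close> by (simp add: mult.assoc[symmetric] C_mult[symmetric] C_1)
    ultimately have "p - C (- (inverse \<beta> * \<alpha>)) \<in> M"
      by (simp add: distrib_left C_minus C_mult add.commute)
    then show ?thesis by blast
  next
    case False
    have MK: "m \<in> core M" if "m \<in> M" for m
    proof -
      obtain \<alpha> \<beta> where ab: "m - (C \<alpha> + C \<beta> * p) \<in> core M" using res by blast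
      then have "C \<alpha> + C \<beta> * p \<in> M"
        using left_ideal_diff_cancel[OF MI core_subset[OF ab]] that by blast
      then have "\<alpha> = 0" "\<beta> = 0" using False by auto
      then show ?thesis using ab by (simp add: C_0)
    qed
    define \<iota> where "\<iota> = Quat 0 1 0 0"
    have unit: "\<iota> * \<iota> = - 1" by (simp add: \<iota>_def quat_eq_iff)
    have notM: "p + C q \<notin> M" for q
    proof
      assume "p + C q \<in> M"
      then have "C q + C 1 * p \<in> M" by (simp add: C_1 add.commute)
      then show False using False by (metis zero_neq_one)
    qed
    have "p + C (- \<iota>) \<notin> M" by (rule notM)
    then obtain r where "1 - r * (p - C \<iota>) \<in> M"
      using maximal_left_ideal_inverse[OF M] by (metis C_minus add_uminus_conv_diff)
    then have "(1 - r * (p - C \<iota>)) * (p + C \<iota>) \<in> M" by (rule core_subset[OF core_mult_right[OF MK]])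
    moreover have "(p - C \<iota>) * (p + C \<iota>) = p * p + 1"
    proof -
      have "C \<iota> * C \<iota> = - 1" by (simp add: C_mult[symmetric] unit C_minus C_1)
      then show ?thesis using centralD[OF p, of "C \<iota>"] by (simp add: algebra_simps)
    qed
    then have "(1 - r * (p - C \<iota>)) * (p + C \<iota>) = (p + C \<iota>) - r * (p * p + 1)"
      by (simp add: left_diff_distrib mult.assoc)
    ultimately have "p + C \<iota> \<in> M"
      using left_ideal_add[OF MI _ left_ideal_mult[OF MI pp, of r]] by fastforce
    then show ?thesis using notM by blast
  qed
qed

text \<open>If all quadratic relations \<open>(X i - c i)\<^sup>2 + (d i)\<^sup>2 \<in> M\<close> have \<open>d i = 0\<close>, the point is real. Otherwise
  one variable with \<open>d k \<noteq> 0\<close> supplies a central \<open>p = (X k - c k) / d k\<close> with \<open>p p + 1 \<in> M\<close>, and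
  \<open>(X i - c i)\<^sup>2 - (d i p)\<^sup>2\<close>, a product of central factors, puts every other variable into the
  real span of \<open>1\<close> and \<open>p\<close>. The coordinates commute because the variables do.\<close>

lemma residue_point:
  assumes M: "maximal_left_ideal M"
  shows "\<exists>a. (\<forall>i j. a i * a j = a j * a i) \<and> (\<forall>i. X i - C (a i) \<in> M)"
proof -
  have MI: "left_ideal M" and 1: "1 \<notin> M" using M by (auto simp: maximal_left_ideal_def)
  obtain c d where cd: "\<And>i. (X i - R (c i))^2 + R ((d i)^2) \<in> M"
    using quadratic_in_maximal[OF M X_central] by metis
  have cen: "central (X i - R (c i))" for i by (intro central_diff X_central R_central)
  have "\<exists>a. \<forall>i. X i - C (a i) \<in> M"
  proof (cases "\<forall>i. d i = 0")
    case True
    have "X i - R (c i) \<in> M" for i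
      using cd[of i] True maximal_central_mult[OF M cen] by (auto simp: power2_eq_square)
    then show ?thesis unfolding R_def by (intro exI[of _ "\<lambda>i. Quat (c i) 0 0 0"] allI)
  next
    case False
    then obtain k where k: "d k \<noteq> 0" by blast
    define p where "p = R (inverse (d k)) * (X k - R (c k))"
    have p: "central p" unfolding p_def by (intro central_mult cen R_central)
    have "R (inverse (d k) * inverse (d k)) * ((X k - R (c k))^2 + R ((d k)^2)) \<in> M"
      by (intro left_ideal_mult[OF MI] cd)
    also have "R (inverse (d k) * inverse (d k)) * ((X k - R (c k))^2 + R ((d k)^2)) = p * p + 1"
    proof -
      have "p * p = R (inverse (d k)) * R (inverse (d k)) * ((X k - R (c k)) * (X k - R (c k)))"
        unfolding p_def
        by (simp only: mult.assoc central_left_commute[OF R_central, where b = "X k - R (c k)"])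
      moreover have "R (inverse (d k) * inverse (d k)) * R ((d k)^2) = 1"
      proof -
        have "inverse (d k) * inverse (d k) * (d k)^2 = 1" using k by (simp add: power2_eq_square field_simps)
        then show ?thesis by (simp add: R_mult[symmetric])
      qed
      ultimately show ?thesis by (simp add: distrib_left power2_eq_square R_mult)
    qed
    finally have pp: "p * p + 1 \<in> M" .
    have Xp: "\<exists>c e. X i - R c - R e * p \<in> M" for i
    proof -
      let ?y = "X i - R (c i)" and ?dp = "R (d i) * p"
      have dp: "?dp * ?dp = R ((d i)^2) * (p * p)"
        by (simp only: mult.assoc central_left_commute[OF R_central, where b = p] R_mult power2_eq_square)
      have "(?y^2 + R ((d i)^2)) - R ((d i)^2) * (p * p + 1) \<in> M"
        by (intro left_ideal_diff[OF MI] left_ideal_mult[OF MI] cd pp)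
      also have "(?y^2 + R ((d i)^2)) - R ((d i)^2) * (p * p + 1) = (?y - ?dp) * (?y + ?dp)"
        using centralD[OF cen[of i], of ?dp]
        by (simp add: power2_eq_square distrib_left distrib_right left_diff_distrib right_diff_distrib dp)
      finally have "?y - ?dp \<in> M \<or> ?y + ?dp \<in> M"
        by (intro maximal_central_mult[OF M] central_add cen central_mult R_central p)
      then have "X i - R (c i) - R (d i) * p \<in> M \<or> X i - R (c i) - R (- d i) * p \<in> M"
        by (simp add: R_minus)
      then show ?thesis by blast
    qed
    then obtain c' e where ce: "\<And>i. X i - R (c' i) - R (e i) * p \<in> M" by metis
    obtain q where q: "p - C q \<in> M" using imaginary_unit_residue[OF M p pp Xp] by blast
    have "X i - C (Quat (c' i) 0 0 0 + Quat (e i) 0 0 0 * q) \<in> M" for i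
    proof -
      have "(X i - R (c' i) - R (e i) * p) + R (e i) * (p - C q) \<in> M"
        by (intro left_ideal_add[OF MI] left_ideal_mult[OF MI] ce q)
      then show ?thesis by (simp add: R_def C_add C_mult algebra_simps)
    qed
    then show ?thesis by (intro exI[of _ "\<lambda>i. Quat (c' i) 0 0 0 + Quat (e i) 0 0 0 * q"] allI)
  qed
  then obtain a where a: "\<And>i. X i - C (a i) \<in> M" by blast
  have "a i * a j = a j * a i" for i j
  proof -
    have *: "X i * X j - C (a j * a i) \<in> M" for i j
    proof -
      have "X i * (X j - C (a j)) + C (a j) * (X i - C (a i)) \<in> M"
        by (intro left_ideal_add[OF MI] left_ideal_mult[OF MI] a)
      then show ?thesis using centralD[OF X_central[of i], of "C (a j)"]
        by (simp add: C_mult algebra_simps)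
    qed
    have "(X i * X j - C (a j * a i)) - (X j * X i - C (a i * a j)) \<in> M"
      by (intro left_ideal_diff[OF MI] *)
    then have "C (a i * a j - a j * a i) \<in> M"
      using centralD[OF X_central[of i], of "X j"] by (simp add: C_diff)
    then have "a i * a j - a j * a i = 0" by (rule const_in_proper[OF MI 1])
    then show ?thesis by simp
  qed
  then show ?thesis using a by blast
qed

end

section \<open>Elimination of an auxiliary variable\<close>

lemma poly_mapping_additive_induct [case_names zero single add]:
  assumes "P 0" "\<And>k v. P (Poly_Mapping.single k v)" "\<And>a b. P a \<Longrightarrow> P b \<Longrightarrow> P (a + b)"
  shows "P (p :: 'k \<Rightarrow>\<^sub>0 'v::comm_monoid_add)"
proof (induction p rule: Poly_Mapping.update_induct)
  case const
  show ?case by (rule assms)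
next
  case (update f a b)
  have "Poly_Mapping.update a b f = f + Poly_Mapping.single a b"
    using update(1)
    by (intro poly_mapping_eqI) (auto simp: lookup_update lookup_add lookup_single in_keys_iff when_def)
  then show ?case using update assms by simp
qed

definition power_span :: "'a::ring_1 set \<Rightarrow> 'a \<Rightarrow> nat \<Rightarrow> 'a set" where
  "power_span I f n = (\<Sum>k\<le>n. right_mult_power I f k)"

lemma mem_power_span:
  "x \<in> power_span I f n \<longleftrightarrow> (\<exists>g. (\<forall>k\<le>n. g k \<in> I) \<and> x = (\<Sum>k\<le>n. g k * f ^ k))"
proof
  assume "x \<in> power_span I f n"
  then obtain s where s: "x = sum s {..n}" "\<And>k. k \<le> n \<Longrightarrow> s k \<in> right_mult_power I f k"
    unfolding power_span_def by (subst (asm) set_sum_alt) auto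
  then have "\<forall>k. \<exists>g. k \<le> n \<longrightarrow> g \<in> I \<and> s k = g * f ^ k"
    unfolding right_mult_power_def by blast
  then obtain g where "\<And>k. k \<le> n \<Longrightarrow> g k \<in> I \<and> s k = g k * f ^ k" by metis
  with s(1) show "\<exists>g. (\<forall>k\<le>n. g k \<in> I) \<and> x = (\<Sum>k\<le>n. g k * f ^ k)"
    by (intro exI[of _ g]) auto
next
  assume "\<exists>g. (\<forall>k\<le>n. g k \<in> I) \<and> x = (\<Sum>k\<le>n. g k * f ^ k)"
  then obtain g where g: "\<And>k. k \<le> n \<Longrightarrow> g k \<in> I" "x = (\<Sum>k\<le>n. g k * f ^ k)" by blast
  then show "x \<in> power_span I f n"
    unfolding power_span_def
    by (subst set_sum_alt)
      (auto simp: right_mult_power_def intro!: exI[of _ "\<lambda>k. g k * f ^ k"])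
qed

lemma left_ideal_power_span:
  assumes I: "left_ideal I" shows "left_ideal (power_span I f n)"
  unfolding left_ideal_def
proof (intro conjI ballI allI)
  show "0 \<in> power_span I f n"
    unfolding mem_power_span by (intro exI[of _ "\<lambda>_. 0"]) (simp add: left_ideal_0[OF I])
  fix x assume "x \<in> power_span I f n"
  then obtain g where g: "\<And>k. k \<le> n \<Longrightarrow> g k \<in> I" "x = (\<Sum>k\<le>n. g k * f ^ k)"
    unfolding mem_power_span by blast
  show "r * x \<in> power_span I f n" for r
    unfolding mem_power_span using g
    by (intro exI[of _ "\<lambda>k. r * g k"]) (simp add: left_ideal_mult[OF I] sum_distrib_left mult.assoc)
  fix y assume "y \<in> power_span I f n"
  then obtain h where h: "\<And>k. k \<le> n \<Longrightarrow> h k \<in> I" "y = (\<Sum>k\<le>n. h k * f ^ k)"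
    unfolding mem_power_span by blast
  show "x + y \<in> power_span I f n"
    unfolding mem_power_span using g h
    by (intro exI[of _ "\<lambda>k. g k + h k"]) (simp add: left_ideal_add[OF I] sum.distrib distrib_right)
qed

lemma mult_power_in_power_span:
  assumes I: "left_ideal I" and "g \<in> I" "k \<le> n"
  shows "g * f ^ k \<in> power_span I f n"
proof -
  have "g * f ^ k = (\<Sum>j\<le>n. (if j = k then g else 0) * f ^ j)"
    using \<open>k \<le> n\<close> by (simp add: if_distrib[of "\<lambda>x. x * _"] sum.delta cong: if_cong)
  then show ?thesis
    unfolding mem_power_span using \<open>g \<in> I\<close> left_ideal_0[OF I]
    by (intro exI[of _ "\<lambda>j. if j = k then g else 0"]) auto
qed

lemma power_span_mono:
  assumes I: "left_ideal I" and "n \<le> m" "x \<in> power_span I f n"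
  shows "x \<in> power_span I f m"
proof -
  obtain g where g: "\<And>k. k \<le> n \<Longrightarrow> g k \<in> I" "x = (\<Sum>k\<le>n. g k * f ^ k)"
    using assms(3) unfolding mem_power_span by blast
  show ?thesis
    unfolding g(2) using g(1) \<open>n \<le> m\<close>
    by (intro left_ideal_sum[OF left_ideal_power_span[OF I]] mult_power_in_power_span[OF I]) auto
qed

text \<open>Polynomials in one central variable \<open>y\<close> over a ring are finitely supported sequences. For
  invertible \<open>f\<close> and \<open>n\<close> at least the degree of \<open>p\<close>, this is the right substitution of \<open>1 / f\<close> for
  \<open>y\<close>, multiplied from the right by \<open>f\<^sup>n\<close> to clear denominators.\<close>

definition scaled_eval :: "'a::ring_1 \<Rightarrow> nat \<Rightarrow> (nat \<Rightarrow>\<^sub>0 'a) \<Rightarrow> 'a" where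
  "scaled_eval f n p = (\<Sum>k\<in>Poly_Mapping.keys p. Poly_Mapping.lookup p k * f ^ (n - k))"

lemma scaled_eval_add: "scaled_eval f n (p + q) = scaled_eval f n p + scaled_eval f n q"
  unfolding scaled_eval_def
  by (rule setsum_keys_plus_distrib[where f = "\<lambda>k c. c * f ^ (n - k)"]) (simp_all add: distrib_right)

lemma scaled_eval_single: "scaled_eval f n (Poly_Mapping.single k c) = c * f ^ (n - k)"
  by (cases "c = 0") (simp_all add: scaled_eval_def)

lemma scaled_eval_0: "scaled_eval f n 0 = 0"
  by (simp add: scaled_eval_def)

lemma scaled_eval_single_mult:
  "scaled_eval f n (Poly_Mapping.single m c * p) = c * scaled_eval f (n - m) p"
  by (induction p rule: poly_mapping_additive_induct)
    (simp_all add: scaled_eval_0 scaled_eval_single mult_single mult.assoc distrib_left scaled_eval_add)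

text \<open>The left ideal is that of all \<open>p\<close> whose scaled value at \<open>1 / f\<close> lies in \<open>I + I f + \<dots> + I f\<^sup>n\<close>
  for all large \<open>n\<close>. Here \<open>1\<close> has the scaled value \<open>f\<^sup>n\<close> and \<open>1 - y f\<close> the scaled value \<open>0\<close>.\<close>

lemma proper_Rabinowitsch_ideal:
  fixes I :: "'a::ring_1 set"
  assumes I: "left_ideal I" and f: "\<And>N. f ^ N \<notin> power_span I f N"
  shows "\<exists>L. left_ideal L \<and> 1 \<notin> L \<and> (\<forall>g\<in>I. Poly_Mapping.single (0::nat) g \<in> L) \<and>
     1 - Poly_Mapping.single 1 f \<in> L"
proof -
  define L where "L = {p. \<exists>N. \<forall>n\<ge>N. scaled_eval f n p \<in> power_span I f n}"
  note W = left_ideal_power_span[OF I]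
  have L0: "0 \<in> L" unfolding L_def by (simp add: scaled_eval_0 left_ideal_0[OF W])
  have Ladd: "p + q \<in> L" if "p \<in> L" "q \<in> L" for p q
  proof -
    obtain N N' where "\<And>n. n \<ge> N \<Longrightarrow> scaled_eval f n p \<in> power_span I f n"
      "\<And>n. n \<ge> N' \<Longrightarrow> scaled_eval f n q \<in> power_span I f n"
      using \<open>p \<in> L\<close> \<open>q \<in> L\<close> unfolding L_def by blast
    then show ?thesis unfolding L_def mem_Collect_eq
      by (intro exI[of _ "max N N'"]) (simp add: scaled_eval_add left_ideal_add[OF W])
  qed
  have "r * p \<in> L" if p: "p \<in> L" for r p
  proof (induction r rule: poly_mapping_additive_induct)
    case (single m c)
    obtain N where N: "\<And>n. n \<ge> N \<Longrightarrow> scaled_eval f n p \<in> power_span I f n"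
      using p unfolding L_def by blast
    have "scaled_eval f n (Poly_Mapping.single m c * p) \<in> power_span I f n" if "n \<ge> N + m" for n
    proof -
      have "scaled_eval f (n - m) p \<in> power_span I f (n - m)" using that by (intro N) simp
      then have "scaled_eval f (n - m) p \<in> power_span I f n"
        by (rule power_span_mono[OF I, rotated]) simp
      then show ?thesis by (simp add: scaled_eval_single_mult left_ideal_mult[OF W])
    qed
    then show ?case unfolding L_def by blast
  qed (auto simp: L0 Ladd distrib_right)
  then have "left_ideal L" using L0 Ladd by (auto simp: left_ideal_def)
  moreover have one: "scaled_eval f n 1 = f ^ n" for n
    using scaled_eval_single[of f n 0 1] by simp
  then have "1 \<notin> L" using f unfolding L_def by auto
  moreover have "Poly_Mapping.single 0 g \<in> L" if "g \<in> I" for g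
    unfolding L_def by (simp add: scaled_eval_single mult_power_in_power_span[OF I that])
  moreover have "1 - Poly_Mapping.single 1 f \<in> L"
  proof -
    have "scaled_eval f n (1 + Poly_Mapping.single 1 (- f)) \<in> power_span I f n" if "n \<ge> 1" for n
    proof -
      have "f * f ^ (n - 1) = f ^ n" using that by (cases n) simp_all
      then show ?thesis by (simp add: scaled_eval_add one scaled_eval_single left_ideal_0[OF W])
    qed
    then have "1 + Poly_Mapping.single 1 (- f) \<in> L" unfolding L_def by blast
    then show ?thesis by (simp add: single_uminus)
  qed
  ultimately show ?thesis by blast
qed

section \<open>Evaluation at central points\<close>

definition var :: "'d \<Rightarrow> 'd qpoly" where
  "var i = Poly_Mapping.single (Poly_Mapping.single i 1) 1"

lemma qpoly_induct:
  fixes f :: "'d qpoly"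
  assumes const: "\<And>q. P (qconst q)" and add: "\<And>a b. P a \<Longrightarrow> P b \<Longrightarrow> P (a + b)"
    and var: "\<And>i a. P a \<Longrightarrow> P (var i * a)"
  shows "P f"
proof -
  have mon: "P a \<Longrightarrow> P (Poly_Mapping.single m 1 * a)" for m a
  proof (induction m arbitrary: a rule: poly_mapping_additive_induct)
    case (single i n)
    show ?case
    proof (induction n)
      case (Suc n)
      have "Poly_Mapping.single (Poly_Mapping.single i (Suc n)) 1 * a =
          var i * (Poly_Mapping.single (Poly_Mapping.single i n) 1 * a)"
        by (simp add: var_def mult.assoc[symmetric] mult_single single_add[symmetric])
      then show ?case using var[OF Suc] by simp
    qed (use single in simp)
  next
    case (add k m)
    have "Poly_Mapping.single (k + m) (1::quat) = Poly_Mapping.single k 1 * Poly_Mapping.single m 1"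
      by (simp add: mult_single)
    then show ?case using add by (simp add: mult.assoc)
  qed simp
  show ?thesis
  proof (induction f rule: poly_mapping_additive_induct)
    case zero
    show ?case using const[of 0] by (simp add: qconst_def)
  next
    case (single m q)
    show ?case using mon[OF const, of m q] by (simp add: qconst_def mult_single)
  qed (rule add)
qed

lemma var_central: "central (var i)"
  unfolding central_def
proof
  fix f show "var i * f = f * var i"
    by (induction f rule: poly_mapping_additive_induct)
      (simp_all add: var_def mult_single add.commute distrib_left distrib_right)
qed

lemma qconst_add: "qconst (p + q) = qconst p + qconst q"
  and qconst_mult: "qconst (p * q) = qconst p * qconst q"
  and qconst_1: "qconst 1 = 1" and qconst_0: "qconst 0 = 0"
  by (simp_all add: qconst_def single_add mult_single)

text \<open>The quaternionic polynomials in the given variables and a new one, the variable \<open>None\<close>.\<close>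

lemma adjoined_variable_generators:
  "quaternionic_generators (\<lambda>q. Poly_Mapping.single (0::nat) (qconst q :: 'd::finite qpoly))
     (\<lambda>i. case i of None \<Rightarrow> Poly_Mapping.single 1 1 | Some i \<Rightarrow> Poly_Mapping.single 0 (var i))"
  (is "quaternionic_generators ?C ?X")
proof
  show "?C 1 = 1" by (simp add: qconst_1)
  show "?C (p + q) = ?C p + ?C q" for p q by (simp add: qconst_add single_add)
  show "?C (p * q) = ?C p * ?C q" for p q by (simp add: qconst_mult mult_single)
  show "central (?X i)" for i
    unfolding central_def
  proof
    fix b show "?X i * b = b * ?X i"
      by (induction b rule: poly_mapping_additive_induct; cases i)
        (simp_all add: mult_single distrib_left distrib_right centralD[OF var_central])
  qed
  fix P and b :: "nat \<Rightarrow>\<^sub>0 'd qpoly"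
  assume const: "\<And>q. P (?C q)" and add: "\<And>a b. P a \<Longrightarrow> P b \<Longrightarrow> P (a + b)"
    and X: "\<And>i a. P a \<Longrightarrow> P (?X i * a)"
  have g: "P (Poly_Mapping.single 0 g)" for g
  proof (induction g rule: qpoly_induct)
    case (3 i a)
    then show ?case using X[of "Poly_Mapping.single 0 a" "Some i"] by (simp add: mult_single)
  qed (auto simp: const add single_add)
  show "P b"
  proof (induction b rule: poly_mapping_additive_induct)
    case zero
    show ?case using const[of 0] by (simp add: qconst_0)
  next
    case (single n h)
    show ?case
    proof (induction n)
      case (Suc n)
      then show ?case using X[of "Poly_Mapping.single n h" None] by (simp add: mult_single)
    qed (rule g)
  qed (rule add)
qed

lemma prod_list_commute:
  fixes c :: "'a::monoid_mult"
  assumes "\<And>y. y \<in> set ys \<Longrightarrow> y * c = c * y"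
  shows "prod_list ys * c = c * prod_list ys"
  using assms by (induction ys) (simp_all, metis mult.assoc)

lemma prod_list_powers_increment:
  fixes a :: "'i \<Rightarrow> 'a::monoid_mult"
  assumes comm: "\<And>i j. a i * a j = a j * a i" and "distinct xs" "i \<in> set xs"
  shows "prod_list (map (\<lambda>j. a j ^ ((if j = i then 1 else 0) + n j)) xs) =
    prod_list (map (\<lambda>j. a j ^ n j) xs) * a i"
  using assms(2,3)
proof (induction xs)
  case (Cons x xs)
  show ?case
  proof (cases "x = i")
    case True
    then have "map (\<lambda>j. a j ^ ((if j = i then 1 else 0) + n j)) xs = map (\<lambda>j. a j ^ n j) xs"
      using Cons.prems by auto
    then have "prod_list (map (\<lambda>j. a j ^ ((if j = i then 1 else 0) + n j)) xs) =
        prod_list (map (\<lambda>j. a j ^ n j) xs)"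
      by (rule arg_cong)
    moreover have "prod_list (map (\<lambda>j. a j ^ n j) xs) * a i = a i * prod_list (map (\<lambda>j. a j ^ n j) xs)"
      by (rule prod_list_commute) (auto simp: power_commuting_commutes[OF comm])
    ultimately show ?thesis using True
      by (simp add: mult.assoc power_commutes[symmetric])
  next
    case False
    then show ?thesis using Cons by (simp add: mult.assoc)
  qed
qed simp

lemma qeval_add: "qeval (f + g) a = qeval f a + qeval g a"
  unfolding qeval_def
  by (rule setsum_keys_plus_distrib[where f = "\<lambda>m c. c * prod_list
      (map (\<lambda>i. a i ^ Poly_Mapping.lookup m i) (sorted_list_of_set UNIV))"]) (simp_all add: distrib_right)

lemma qeval_0: "qeval 0 a = 0"
  by (simp add: qeval_def)

lemma qeval_single: "qeval (Poly_Mapping.single m c) a =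
    c * prod_list (map (\<lambda>i. a i ^ Poly_Mapping.lookup m i) (sorted_list_of_set UNIV))"
  by (cases "c = 0") (simp_all add: qeval_def)

lemma qeval_const: "qeval (qconst q) a = q"
proof -
  have "prod_list (map (\<lambda>i. 1) xs) = (1::quat)" for xs :: "'a list" by (induction xs) simp_all
  then show ?thesis by (simp add: qconst_def qeval_single)
qed

lemma qeval_1: "qeval 1 a = 1"
  using qeval_const[of 1 a] by (simp add: qconst_1)

lemma qeval_const_mult: "qeval (qconst q * f) a = q * qeval f a"
  by (induction f rule: poly_mapping_additive_induct)
    (simp_all add: qeval_0 qeval_add qeval_single qconst_def mult_single mult.assoc distrib_left)

lemma qeval_diff: "qeval (f - g) a = qeval f a - qeval g a"
  using qeval_add[of "f - g" g a] by (simp add: algebra_simps)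

lemma qeval_sum: "qeval (sum f K) a = (\<Sum>k\<in>K. qeval (f k) a)"
  by (induction K rule: infinite_finite_induct) (simp_all add: qeval_0 qeval_add)

lemma qeval_var_mult:
  assumes "a \<in> central_points" shows "qeval (var i * f) a = qeval f a * a i"
proof (induction f rule: poly_mapping_additive_induct)
  case (single m c)
  have "prod_list (map (\<lambda>j. a j ^ ((if j = i then 1 else 0) + Poly_Mapping.lookup m j)) (sorted_list_of_set UNIV))
      = prod_list (map (\<lambda>j. a j ^ Poly_Mapping.lookup m j) (sorted_list_of_set UNIV)) * a i"
    using assms by (intro prod_list_powers_increment) (auto simp: central_points_def)
  moreover have "Poly_Mapping.lookup (Poly_Mapping.single i 1 + m) =
      (\<lambda>j. (if j = i then 1 else 0) + Poly_Mapping.lookup m j)"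
    by (auto simp: lookup_add lookup_single when_def)
  ultimately show ?case by (simp add: var_def mult_single qeval_single mult.assoc)
qed (simp_all add: qeval_0 qeval_add distrib_left distrib_right)

text \<open>A monomial of \<open>f\<close> evaluates on \<open>f * h\<close> with the value of \<open>h\<close> between its coefficient and its powers
  of \<open>a\<close>. Evaluation is multiplicative once that value can be moved past the coordinates; the cases
  needed are the values \<open>0\<close> and \<open>1\<close>.\<close>

lemma qeval_mult:
  assumes a: "a \<in> central_points" and e: "\<And>i. qeval h a * a i = a i * qeval h a"
  shows "qeval (f * h) a = qeval f a * qeval h a"
proof (induction f rule: qpoly_induct)
  case (3 i f)
  then show ?case by (simp add: qeval_var_mult[OF a] mult.assoc e)
qed (simp_all add: qeval_const_mult qeval_const qeval_add distrib_right)

lemma qeval_mult_eq_0: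
  assumes "a \<in> central_points" "qeval h a = 0" shows "qeval (f * h) a = 0"
  using qeval_mult[OF assms(1), of h f] assms(2) by simp

lemma qeval_mult_1:
  assumes "a \<in> central_points" "qeval h a = 1" shows "qeval (f * h) a = qeval f a"
  using qeval_mult[OF assms(1), of h f] assms(2) by simp

lemma maximal_vanishing_ideal:
  assumes a: "a \<in> central_points" shows "maximal_left_ideal {g. qeval g a = 0}"
  unfolding maximal_left_ideal_def
proof (intro conjI allI impI)
  show "left_ideal {g. qeval g a = 0}"
    by (auto simp: left_ideal_def qeval_0 qeval_add qeval_mult_eq_0[OF a])
  show "1 \<notin> {g. qeval g a = 0}" by (simp add: qeval_1)
  fix J assume J: "left_ideal J \<and> {g. qeval g a = 0} \<subseteq> J \<and> 1 \<notin> J"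
  have "qeval b a = 0" if "b \<in> J" for b
  proof (rule ccontr)
    assume b: "qeval b a \<noteq> 0"
    let ?h = "qconst (inverse (qeval b a)) * b"
    have "qeval (1 - ?h) a = 0" using b by (simp add: qeval_diff qeval_1 qeval_const_mult)
    then have "1 - ?h \<in> J" using J by auto
    moreover have "?h \<in> J" using J that by (auto intro: left_ideal_mult)
    ultimately have "(1 - ?h) + ?h \<in> J" using J by (blast intro: left_ideal_add)
    then show False using J by simp
  qed
  then show "J = {g. qeval g a = 0}" using J by auto
qed

section \<open>Power relations on the radical\<close>

text \<open>A zero of the Rabinowitsch left ideal would be a zero of \<open>I\<close>, hence of \<open>f\<close>, at which \<open>1 - y f\<close>
  has the value \<open>1\<close>. So that left ideal cannot be proper.\<close>

lemma radical_power_relation: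
  fixes I :: "'d::{finite,linorder} qpoly set"
  assumes I: "left_ideal I" and f: "f \<in> qradical I"
  shows "\<exists>N. f ^ N \<in> power_span I f N"
proof (rule ccontr)
  assume "\<not> ?thesis"
  then obtain L where L: "left_ideal L" "1 \<notin> L" "\<And>g. g \<in> I \<Longrightarrow> Poly_Mapping.single (0::nat) g \<in> L"
    "1 - Poly_Mapping.single 1 f \<in> L"
    using proper_Rabinowitsch_ideal[OF I] by blast
  obtain M where M: "maximal_left_ideal M" "L \<subseteq> M" using ex_maximal_left_ideal[OF L(1,2)] by blast
  have MI: "left_ideal M" and 1: "1 \<notin> M" using M by (auto simp: maximal_left_ideal_def)
  interpret B: quaternionic_generators "\<lambda>q. Poly_Mapping.single (0::nat) (qconst q :: 'd qpoly)"
    "\<lambda>i. case i of None \<Rightarrow> Poly_Mapping.single 1 1 | Some i \<Rightarrow> Poly_Mapping.single 0 (var i)"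
    by (rule adjoined_variable_generators)
  let ?C = "\<lambda>q. Poly_Mapping.single (0::nat) (qconst q :: 'd qpoly)"
  obtain a0 where a0: "\<And>i j. a0 i * a0 j = a0 j * a0 i"
    "\<And>i. (case i of None \<Rightarrow> Poly_Mapping.single 1 1 | Some i \<Rightarrow> Poly_Mapping.single 0 (var i)) - ?C (a0 i) \<in> M"
    using B.residue_point[OF M(1)] by blast
  define a where "a i = a0 (Some i)" for i
  have a: "a \<in> central_points" using a0(1) by (auto simp: a_def central_points_def)
  have aM: "Poly_Mapping.single 0 (var i) - ?C (a i) \<in> M" for i using a0(2)[of "Some i"] by (simp add: a_def)
  have ev: "Poly_Mapping.single 0 g - ?C (qeval g a) \<in> M" for g
  proof (induction g rule: qpoly_induct)
    case (1 q)
    then show ?case by (simp add: qeval_const left_ideal_0[OF MI])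
  next
    case (2 g h)
    then show ?case using left_ideal_add[OF MI 2] by (simp add: qeval_add single_add qconst_add algebra_simps)
  next
    case (3 i g)
    let ?e = "qeval g a" and ?x = "Poly_Mapping.single 0 (var i)"
    have "?x * (Poly_Mapping.single 0 g - ?C ?e) + ?C ?e * (?x - ?C (a i)) \<in> M"
      by (intro left_ideal_add[OF MI] left_ideal_mult[OF MI] 3 aM)
    moreover have "?x * ?C ?e = ?C ?e * ?x" by (simp add: mult_single centralD[OF var_central])
    ultimately show ?case
      by (simp add: right_diff_distrib) (simp add: mult_single qeval_var_mult[OF a] qconst_mult)
  qed
  have "qeval g a = 0" if "g \<in> I" for g
  proof -
    have "Poly_Mapping.single 0 g \<in> M" using L(3)[OF that] M(2) by blast
    then have "?C (qeval g a) \<in> M" using left_ideal_diff_cancel[OF MI ev] by blast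
    then show ?thesis by (rule B.const_in_proper[OF MI 1])
  qed
  then have "a \<in> zero_locus I" using a by (simp add: zero_locus_def)
  then have "qeval f a = 0" using f by (simp add: qradical_def)
  then have "Poly_Mapping.single 0 f \<in> M" using ev[of f] by (simp add: qconst_0)
  then have "Poly_Mapping.single 1 1 * Poly_Mapping.single 0 f \<in> M" by (rule left_ideal_mult[OF MI])
  then have "(1 - Poly_Mapping.single 1 f) + Poly_Mapping.single 1 f \<in> M"
    using L(4) M(2) by (intro left_ideal_add[OF MI]) (auto simp: mult_single)
  then show False using 1 by simp
qed

text \<open>Normalising \<open>f\<close> from the left to have value \<open>1\<close> at a point \<open>a\<close> makes right multiplication by it
  invisible to evaluation at \<open>a\<close>. This is why all multiples \<open>b f\<close> have to satisfy a power relation.\<close>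

lemma power_relations_imp_radical:
  assumes f: "\<And>b. \<exists>N. (qconst b * f) ^ N \<in> power_span I (qconst b * f) N"
  shows "f \<in> qradical I"
  unfolding qradical_def mem_Collect_eq
proof (intro ballI, rule ccontr)
  fix a assume aI: "a \<in> zero_locus I" and nz: "qeval f a \<noteq> 0"
  then have a: "a \<in> central_points" by (simp add: zero_locus_def)
  define h where "h = qconst (inverse (qeval f a)) * f"
  have h: "qeval h a = 1" using nz by (simp add: h_def qeval_const_mult)
  have pow: "qeval (g * h ^ k) a = qeval g a" for g k
    by (induction k arbitrary: g) (simp_all add: power_Suc2 mult.assoc[symmetric] qeval_mult_1[OF a h] del: power_Suc)
  obtain N where "h ^ N \<in> power_span I h N" using f unfolding h_def by blast
  then obtain g where g: "\<And>k. k \<le> N \<Longrightarrow> g k \<in> I" "h ^ N = (\<Sum>k\<le>N. g k * h ^ k)"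
    unfolding mem_power_span by blast
  have "qeval (h ^ N) a = 0"
    unfolding g(2) qeval_sum pow using g(1) aI by (intro sum.neutral) (auto simp: zero_locus_def)
  then show False using pow[of 1 N] by (simp add: qeval_1)
qed

section \<open>Conjugation, trace and norm\<close>

definition quat_cnj :: "quat \<Rightarrow> quat" where
  "quat_cnj q = Quat (q1 q) (- qi q) (- qj q) (- qk q)"

definition qconj :: "'d qpoly \<Rightarrow> 'd qpoly" where
  "qconj f = Poly_Mapping.map quat_cnj f"

lemma lookup_qconj: "Poly_Mapping.lookup (qconj f) m = quat_cnj (Poly_Mapping.lookup f m)"
  unfolding qconj_def map.rep_eq by (simp add: when_def quat_cnj_def quat_eq_iff)

lemma qconj_add: "qconj (f + g) = qconj f + qconj g"
  by (rule poly_mapping_eqI) (simp add: lookup_qconj lookup_add quat_cnj_def quat_eq_iff)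

lemma qconj_conj [simp]: "qconj (qconj f) = f"
  by (rule poly_mapping_eqI) (simp add: lookup_qconj quat_cnj_def quat_eq_iff)

lemma qconj_0 [simp]: "qconj 0 = 0"
  by (rule poly_mapping_eqI) (simp add: lookup_qconj quat_cnj_def quat_eq_iff)

lemma qconj_single: "qconj (Poly_Mapping.single m q) = Poly_Mapping.single m (quat_cnj q)"
  by (rule poly_mapping_eqI) (simp add: lookup_qconj lookup_single when_def quat_cnj_def quat_eq_iff)

lemma qconj_mult: "qconj (f * g) = qconj g * qconj f"
proof (induction f rule: poly_mapping_additive_induct)
  case (single m p)
  show ?case
  proof (induction g rule: poly_mapping_additive_induct)
    case (single n q)
    have "quat_cnj (p * q) = quat_cnj q * quat_cnj p" by (simp add: quat_cnj_def quat_eq_iff)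
    then show ?case by (simp add: mult_single qconj_single add.commute)
  qed (simp_all add: qconj_add distrib_left distrib_right)
qed (simp_all add: qconj_add distrib_left distrib_right)

definition qtrace :: "'d qpoly \<Rightarrow> 'd qpoly" where
  "qtrace f = f + qconj f"

lemma qtrace_add: "qtrace (f + g) = qtrace f + qtrace g"
  by (simp add: qtrace_def qconj_add)

lemma qtrace_qconj: "qtrace (qconj f) = qtrace f"
  by (simp add: qtrace_def add.commute)

lemma qtrace_central: "central (qtrace f)"
proof (induction f rule: poly_mapping_additive_induct)
  case zero
  then show ?case by (simp add: qtrace_def central_def)
next
  case (single m q)
  show ?case
    unfolding central_def
  proof
    fix g
    show "qtrace (Poly_Mapping.single m q) * g = g * qtrace (Poly_Mapping.single m q)"
    proof (induction g rule: poly_mapping_additive_induct)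
      case (single n p)
      have "(q + quat_cnj q) * p = p * (q + quat_cnj q)" by (simp add: quat_cnj_def quat_eq_iff)
      then show ?case
        by (simp add: qtrace_def qconj_single single_add[symmetric] mult_single add.commute)
    qed (simp_all add: distrib_left distrib_right)
  qed
next
  case (add f g)
  then show ?case by (simp add: qtrace_add central_add)
qed

lemma lookup_qconst_mult: "Poly_Mapping.lookup (qconst c * f) m = c * Poly_Mapping.lookup f m"
  by (induction f rule: poly_mapping_additive_induct)
    (simp_all add: qconst_def mult_single lookup_add lookup_single when_def distrib_left)

text \<open>Such an \<open>f\<close> is the trace of \<open>f / 2\<close>.\<close>

lemma qconj_eq_imp_central:
  assumes "qconj f = f" shows "central f"
proof -
  define c where "c = Quat (1/2) 0 0 0"
  have "c * q + quat_cnj (c * q) = q" if "quat_cnj q = q" for q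
    using that by (simp add: c_def quat_cnj_def quat_eq_iff)
  then have "qtrace (qconst c * f) = f"
    using assms by (intro poly_mapping_eqI) (metis lookup_add lookup_qconj lookup_qconst_mult qtrace_def)
  then show ?thesis using qtrace_central[of "qconst c * f"] by simp
qed

lemma norm_central: "central (qconj f * f)"
  by (rule qconj_eq_imp_central) (simp add: qconj_mult)

lemma square_eq: "f * f = qtrace f * f - qconj f * f"
  by (simp add: qtrace_def distrib_right)

lemma norm_commute: "f * qconj f = qconj f * f"
proof -
  have "qtrace f * f = f * qtrace f" by (rule centralD[OF qtrace_central])
  then show ?thesis by (simp add: qtrace_def distrib_left distrib_right)
qed

text \<open>Polarisation of \<open>norm_commute\<close>.\<close>

lemma qtrace_mult_commute: "qtrace (f * g) = qtrace (g * f)"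
proof -
  have "(f + qconj g) * qconj (f + qconj g) = qconj (f + qconj g) * (f + qconj g)" by (rule norm_commute)
  then show ?thesis
    using norm_commute[of f] norm_commute[of g]
    by (simp add: qtrace_def qconj_add qconj_mult algebra_simps)
qed

text \<open>Traces in \<open>J\<close> are central and therefore belong to the core. The four real coordinates of \<open>f\<close> are,
  up to the factor \<open>1/2\<close> and signs, the traces of the products of \<open>f\<close> with the quaternion units.\<close>

lemma core_of_traces:
  assumes J: "left_ideal J" and tr: "\<And>r. qtrace (r * f) \<in> J"
  shows "f \<in> core J"
proof -
  note KJ = left_ideal_core[OF J]
  have K: "qtrace (r * f) \<in> core J" for r by (rule central_in_core[OF J qtrace_central tr])
  let ?i = "Quat 0 1 0 0" and ?j = "Quat 0 0 1 0" and ?k = "Quat 0 0 0 1"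
  have "f = qconst (Quat (1/2) 0 0 0) * (qtrace (1 * f) - qconst ?i * qtrace (qconst ?i * f)
      - qconst ?j * qtrace (qconst ?j * f) - qconst ?k * qtrace (qconst ?k * f))"
    by (rule poly_mapping_eqI)
      (simp add: lookup_qconst_mult lookup_minus qtrace_def lookup_add lookup_qconj quat_cnj_def quat_eq_iff)
  also have "\<dots> \<in> core J"
    by (intro left_ideal_mult[OF KJ] left_ideal_diff[OF KJ] K)
  finally show ?thesis .
qed

text \<open>The norm maps \<open>J\<close> into \<open>J\<close>, so its polar form \<open>tr (r f g\<^sup>*)\<close> does as well.\<close>

lemma mult_qconj_in_core:
  assumes J: "left_ideal J" and "f \<in> J" "g \<in> J"
  shows "f * qconj g \<in> core J"
proof (rule core_of_traces[OF J])
  fix r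
  let ?h = "r * f + g"
  have n: "x * qconj x \<in> J" if "x \<in> J" for x
    using that by (simp add: norm_commute left_ideal_mult[OF J])
  have "?h * qconj ?h - (r * f) * qconj (r * f) - g * qconj g \<in> J"
    by (intro left_ideal_diff[OF J] n left_ideal_add[OF J] left_ideal_mult[OF J] assms)
  also have "?h * qconj ?h - (r * f) * qconj (r * f) - g * qconj g = qtrace (r * (f * qconj g))"
    by (simp add: qtrace_def qconj_add qconj_mult algebra_simps)
  finally show "qtrace (r * (f * qconj g)) \<in> J" .
qed

section \<open>Semiprime left ideals\<close>

lemma semiprime_cancel_square:
  assumes J: "semiprime_left_ideal J" and s: "central s" and "s * (s * g) \<in> J"
  shows "s * g \<in> J"
proof -
  have JI: "left_ideal J" using J by (simp add: semiprime_left_ideal_def)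
  have "(s * g) * r * (s * g) \<in> J" for r
  proof -
    have "(g * r) * (s * (s * g)) \<in> J" by (rule left_ideal_mult[OF JI assms(3)])
    also have "(g * r) * (s * (s * g)) = s * ((g * r) * (s * g))" by (rule central_left_commute[OF s])
    finally show ?thesis by (simp add: mult.assoc)
  qed
  then show ?thesis using J unfolding semiprime_left_ideal_def by blast
qed

lemma semiprime_cancel_power:
  assumes J: "semiprime_left_ideal J" and s: "central s" and "s ^ k * g \<in> J"
  shows "s * g \<in> J"
  using assms(3)
proof (induction k)
  case 0
  then show ?case using J by (simp add: semiprime_left_ideal_def left_ideal_mult)
next
  case (Suc k)
  show ?case
  proof (cases k)
    case 0
    then show ?thesis using Suc by simp
  next
    case (Suc m)
    then have "s * (s * (s ^ m * g)) \<in> J" using Suc.prems by (simp add: mult.assoc)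
    then have "s * (s ^ m * g) \<in> J" by (rule semiprime_cancel_square[OF J s])
    then show ?thesis using Suc.IH Suc by (simp add: mult.assoc)
  qed
qed

lemma power_span_stable:
  assumes J: "left_ideal J" and stable: "\<And>g. g \<in> J \<Longrightarrow> g * f \<in> J" and "x \<in> power_span J f N"
  shows "x \<in> J"
proof -
  have "g * f ^ k \<in> J" if "g \<in> J" for g k
    using that by (induction k) (simp_all add: power_Suc2 mult.assoc[symmetric] stable del: power_Suc)
  then show ?thesis using assms(3) unfolding mem_power_span by (auto intro!: left_ideal_sum[OF J])
qed

text \<open>The core argument, in which \<open>S\<close> stands for the radical of \<open>J\<close>. Think of \<open>J\<close> as the matrices of
  size two that annihilate a vector \<open>v\<close>: then \<open>u\<^sup>*\<close> for \<open>u \<in> J\<close> is the adjugate matrix, with image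
  spanned by \<open>v\<close>, and \<open>u\<^sup>* x f\<close> maps \<open>v\<close> to a multiple of itself. The power relation forces this
  multiple, which is the trace of \<open>u\<^sup>* x f\<close>, to be zero.\<close>

lemma semiprime_contains_power_related:
  fixes J S :: "'d qpoly set"
  assumes J: "semiprime_left_ideal J" and S: "left_ideal S"
    and nil: "\<And>h. h \<in> S \<Longrightarrow> \<exists>N. h ^ N \<in> power_span J h N"
    and f: "f \<in> S"
  shows "f \<in> J"
proof -
  have JI: "left_ideal J" using J by (simp add: semiprime_left_ideal_def)
  note KI = left_ideal_core[OF JI]
  \<comment> \<open>Right multiplication by a central element preserves \<open>J\<close>, so the power
      relation for the norm becomes membership of a power.\<close>
  have norm: "qconj h * h \<in> J" if "h \<in> S" for h
  proof -
    let ?n = "qconj h * h"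
    have "?n \<in> S" using that by (rule left_ideal_mult[OF S])
    then obtain N where "?n ^ N \<in> power_span J ?n N" using nil by blast
    then have "?n ^ N \<in> J"
      by (rule power_span_stable[OF JI, rotated])
        (simp add: centralD[OF norm_central, symmetric] left_ideal_mult[OF JI])
    then have "?n ^ N * 1 \<in> J" by simp
    then have "?n * 1 \<in> J" by (rule semiprime_cancel_power[OF J norm_central])
    then show ?thesis by simp
  qed
  \<comment> \<open>As the norm of \<open>h\<close> is negligible, \<open>h * h\<close> may be replaced by
      \<open>qtrace h * h\<close> in every power of \<open>h\<close>.\<close>
  have trace: "qtrace h * h \<in> J" if h: "h \<in> S" and stable: "\<And>g. g \<in> J \<Longrightarrow> g * h \<in> J" for h
  proof -
    have nK: "qconj h * h \<in> core J" by (rule central_in_core[OF JI norm_central norm[OF h]])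
    have pow: "h * h ^ k - qtrace h ^ k * h \<in> core J" for k
    proof (induction k)
      case 0
      show ?case using left_ideal_0[OF KI] by simp
    next
      case (Suc k)
      have "h * (h * h ^ k - qtrace h ^ k * h) - qtrace h ^ k * (qconj h * h) \<in> core J"
        by (intro left_ideal_diff[OF KI] left_ideal_mult[OF KI] Suc nK)
      moreover have "h * (qtrace h ^ k * h) = qtrace h ^ k * (qtrace h * h) - qtrace h ^ k * (qconj h * h)"
        by (subst central_left_commute[OF central_power[OF qtrace_central]])
          (simp add: square_eq right_diff_distrib)
      ultimately show ?case
        by (simp add: right_diff_distrib power_Suc2[of "qtrace h"] mult.assoc del: power_Suc) (simp add: mult.assoc)
    qed
    obtain N where "h ^ N \<in> power_span J h N" using nil h by blast
    then have "h ^ N \<in> J" using power_span_stable[OF JI, of h] stable by blast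
    then have "h * h ^ N \<in> J" by (rule left_ideal_mult[OF JI])
    then have "qtrace h ^ N * h \<in> J" using left_ideal_diff_cancel[OF JI core_subset[OF pow]] by blast
    then show ?thesis by (rule semiprime_cancel_power[OF J qtrace_central])
  qed
  have polar: "qtrace h * h' \<in> J"
    if h: "h \<in> S" "\<And>g. g \<in> J \<Longrightarrow> g * h \<in> J" and h': "h' \<in> S" "\<And>g. g \<in> J \<Longrightarrow> g * h' \<in> J" for h h'
  proof -
    have "qtrace (h + h') * (h + h') \<in> J"
    proof (rule trace)
      show "h + h' \<in> S" by (rule left_ideal_add[OF S h(1) h'(1)])
      show "g * (h + h') \<in> J" if "g \<in> J" for g
        unfolding distrib_left by (rule left_ideal_add[OF JI h(2)[OF that] h'(2)[OF that]])
    qed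
    moreover have t: "qtrace h * h \<in> J" by (rule trace) (fact h)+
    moreover have "qtrace h' * h' \<in> J" by (rule trace) (fact h')+
    ultimately have "qtrace (h + h') * (h + h') - qtrace h * h - qtrace h' * h' \<in> J"
      by (intro left_ideal_diff[OF JI])
    then have "qtrace h * h' + qtrace h' * h \<in> J" by (simp add: qtrace_add algebra_simps)
    then have "qtrace h * (qtrace h * h' + qtrace h' * h) - qtrace h' * (qtrace h * h) \<in> J"
      by (intro left_ideal_diff[OF JI] left_ideal_mult[OF JI] t)
    moreover have "qtrace h * (qtrace h' * h) = qtrace h' * (qtrace h * h)"
      by (rule central_left_commute[OF qtrace_central])
    ultimately have "qtrace h * (qtrace h * h') \<in> J" by (simp add: distrib_left)
    then show ?thesis by (rule semiprime_cancel_square[OF J qtrace_central])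
  qed
  have traces: "qtrace (x * f * qconj u) \<in> J" if u: "u \<in> J" for u x
  proof -
    let ?h = "qconj u * (x * f)"
    \<comment> \<open>The element and its conjugate, both multiplied by the trace, lie in
        \<open>J\<close>: the conjugate ends in \<open>u\<close>. Their sum is the square of
        the trace.\<close>
    have "qtrace ?h * ?h \<in> J"
    proof (rule trace)
      show "?h \<in> S" by (intro left_ideal_mult[OF S] f)
      fix g assume "g \<in> J"
      then have "g * qconj u * (x * f) \<in> core J" using core_mult_right[OF mult_qconj_in_core[OF JI _ u]] by blast
      then show "g * ?h \<in> J" by (simp add: mult.assoc core_subset)
    qed
    moreover have "qtrace ?h * qconj ?h \<in> J"
    proof -
      have "qtrace ?h * (qconj (x * f) * u) \<in> J" by (intro left_ideal_mult[OF JI] u)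
      then show ?thesis by (simp add: qconj_mult[of "qconj u"])
    qed
    ultimately have "qtrace ?h * ?h + qtrace ?h * qconj ?h \<in> J" by (rule left_ideal_add[OF JI])
    then have "qtrace ?h * (qtrace ?h * 1) \<in> J" by (simp add: distrib_left[symmetric] qtrace_def[symmetric])
    then have "qtrace ?h * 1 \<in> J" by (rule semiprime_cancel_square[OF J qtrace_central])
    then show ?thesis using qtrace_mult_commute[of "qconj u" "x * f"] by simp
  qed
  \<comment> \<open>On \<open>J\<close>, right multiplication by \<open>x * f\<close> is multiplication by
      its trace, up to \<open>g * qconj (x * f)\<close>, whose traces were just shown to be
      in \<open>J\<close>.\<close>
  have stable: "g * (x * f) \<in> J" if g: "g \<in> J" for g x
  proof -
    have "g * qconj (x * f) \<in> core J"
    proof (rule core_of_traces[OF JI])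
      fix r
      have "qtrace (x * f * qconj (r * g)) \<in> J" by (intro traces left_ideal_mult[OF JI] g)
      also have "qtrace (x * f * qconj (r * g)) = qtrace (r * (g * qconj (x * f)))"
        by (subst qtrace_qconj[symmetric]) (simp add: qconj_mult mult.assoc)
      finally show "qtrace (r * (g * qconj (x * f))) \<in> J" .
    qed
    then have "qtrace (x * f) * g - g * qconj (x * f) \<in> J"
      by (rule left_ideal_diff[OF JI left_ideal_mult[OF JI g] core_subset])
    moreover have "qtrace (x * f) * g = g * (x * f) + g * qconj (x * f)"
      by (subst centralD[OF qtrace_central]) (simp add: qtrace_def distrib_left)
    ultimately show ?thesis by simp
  qed
  have "f * r * f \<in> J" for r
  proof -
    have "qtrace (r * f) * f \<in> J"
      using stable[of _ r] stable[of _ 1] by (intro polar f left_ideal_mult[OF S]) auto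
    moreover have "f * qconj f * qconj r \<in> J"
      unfolding norm_commute
      by (rule core_subset[OF core_mult_right[OF central_in_core[OF JI norm_central norm[OF f]]]])
    ultimately have "qtrace (r * f) * f - f * qconj f * qconj r \<in> J" by (rule left_ideal_diff[OF JI])
    moreover have "qtrace (r * f) * f = f * r * f + f * qconj f * qconj r"
      by (subst centralD[OF qtrace_central]) (simp add: qtrace_def qconj_mult distrib_left mult.assoc)
    ultimately show ?thesis by simp
  qed
  then show ?thesis using J unfolding semiprime_left_ideal_def by blast
qed

text \<open>Complete primeness always applies to products with a central second factor. Applied to the square
  of the norm of \<open>f\<close> and to \<open>f tr(r f) = f r f + f f\<^sup>* r\<^sup>*\<close>, it puts the norm and all these traces
  into \<open>J\<close> unless \<open>f \<in> J\<close>; but if all traces are in \<open>J\<close>, so is \<open>f\<close>.\<close>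

lemma completely_prime_imp_semiprime:
  fixes J :: "'d qpoly set"
  assumes "completely_prime_left_ideal J" shows "semiprime_left_ideal J"
proof -
  have J: "left_ideal J"
    and cp: "\<And>a b. a * b \<in> J \<Longrightarrow> (\<And>g. g \<in> J \<Longrightarrow> g * b \<in> J) \<Longrightarrow> a \<in> J \<or> b \<in> J"
    using assms unfolding completely_prime_left_ideal_def by blast+
  have cp': "a \<in> J \<or> b \<in> J" if "central b" "a * b \<in> J" for a b
    using that by (intro cp) (simp_all add: centralD[of b, symmetric] left_ideal_mult[OF J])
  have "f \<in> J" if f: "{f * r * f | r. True} \<subseteq> J" for f
  proof (rule ccontr)
    assume nf: "f \<notin> J"
    have fJ: "f * r * f \<in> J" for r using f by blast
    have "qconj f * (f * qconj f * f) \<in> J" by (intro left_ideal_mult[OF J] fJ)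
    then have "(qconj f * f) * (qconj f * f) \<in> J" by (simp add: mult.assoc)
    then have n: "qconj f * f \<in> J" using cp'[OF norm_central] by blast
    have "qtrace (r * f) \<in> J" for r
    proof -
      have "f * qconj f * qconj r \<in> J"
        unfolding norm_commute
        by (rule core_subset[OF core_mult_right[OF central_in_core[OF J norm_central n]]])
      then have "f * r * f + f * qconj f * qconj r \<in> J" by (intro left_ideal_add[OF J] fJ)
      then have "f * qtrace (r * f) \<in> J" by (simp add: qtrace_def qconj_mult distrib_left mult.assoc)
      then show ?thesis using cp'[OF qtrace_central] nf by blast
    qed
    then have "f \<in> core J" by (rule core_of_traces[OF J])
    then show False using nf core_subset by blast
  qed
  then show ?thesis using J by (simp add: semiprime_left_ideal_def)
qed

section \<open>Characterisations of the radical\<close>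

lemma left_ideal_qradical: "left_ideal (qradical I)"
  by (auto simp: left_ideal_def qradical_def zero_locus_def qeval_0 qeval_add qeval_mult_eq_0)

lemma subset_qradical: "I \<subseteq> qradical I"
  by (auto simp: qradical_def zero_locus_def)

lemma qradical_mono: "I \<subseteq> J \<Longrightarrow> qradical I \<subseteq> qradical J"
  by (auto simp: qradical_def zero_locus_def)

lemma qradical_subset_semiprime:
  assumes J: "semiprime_left_ideal J" and "I \<subseteq> J"
  shows "qradical I \<subseteq> J"
proof
  fix f assume "f \<in> qradical I"
  then have f: "f \<in> qradical J" using qradical_mono[OF \<open>I \<subseteq> J\<close>] by blast
  have JI: "left_ideal J" using J by (simp add: semiprime_left_ideal_def)
  show "f \<in> J"
    by (rule semiprime_contains_power_related[OF J left_ideal_qradical _ f])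
      (rule radical_power_relation[OF JI])
qed

lemma qradical_eq_Inter_vanishing:
  "qradical I = (\<Inter>a\<in>zero_locus I. {g. qeval g a = 0})"
  by (auto simp: qradical_def)

theorem theorem1p2:
  fixes I :: "'d::{finite,linorder} qpoly set"
  assumes "left_ideal I"
  shows "qradical I = {f. \<forall>b::quat. \<exists>N::nat.
           (qconst b * f) ^ N \<in> (\<Sum>k\<le>N. right_mult_power I (qconst b * f) k)}
    \<and> qradical I = \<Inter> {J. completely_prime_left_ideal J \<and> I \<subseteq> J}
    \<and> qradical I = \<Inter> {J. prime_left_ideal J \<and> I \<subseteq> J}
    \<and> (semiprime_left_ideal (qradical I) \<and> I \<subseteq> qradical I \<and>
         (\<forall>J. semiprime_left_ideal J \<and> I \<subseteq> J \<longrightarrow> qradical I \<subseteq> J))"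
proof (intro conjI allI impI)
  have point: "maximal_left_ideal {g. qeval g a = 0}" "I \<subseteq> {g. qeval g a = 0}" if "a \<in> zero_locus I" for a
    using that by (auto simp: zero_locus_def intro: maximal_vanishing_ideal)
  have prime_semiprime: "semiprime_left_ideal J" if "prime_left_ideal J" for J :: "'d qpoly set"
    using that unfolding prime_left_ideal_def semiprime_left_ideal_def by blast
  have bf: "qconst b * f \<in> qradical I" if "f \<in> qradical I" for b f
    using that by (rule left_ideal_mult[OF left_ideal_qradical])
  show "qradical I = {f. \<forall>b::quat. \<exists>N::nat.
           (qconst b * f) ^ N \<in> (\<Sum>k\<le>N. right_mult_power I (qconst b * f) k)}"
    unfolding power_span_def[symmetric]
  proof (intro equalityI subsetI CollectI allI)
    fix f b assume "f \<in> qradical I"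
    then show "\<exists>N. (qconst b * f) ^ N \<in> power_span I (qconst b * f) N"
      by (intro radical_power_relation[OF assms] bf)
  next
    fix f assume "f \<in> {f. \<forall>b. \<exists>N. (qconst b * f) ^ N \<in> power_span I (qconst b * f) N}"
    then show "f \<in> qradical I" by (intro power_relations_imp_radical) simp
  qed
  have Inter: "qradical I = \<Inter> {J. P J \<and> I \<subseteq> J}"
    if "\<And>J. P J \<Longrightarrow> semiprime_left_ideal J" "\<And>M. maximal_left_ideal M \<Longrightarrow> P M" for P
  proof
    show "qradical I \<subseteq> \<Inter> {J. P J \<and> I \<subseteq> J}"
    proof (rule Inter_greatest)
      fix J assume "J \<in> {J. P J \<and> I \<subseteq> J}"
      then show "qradical I \<subseteq> J" using that(1) by (intro qradical_subset_semiprime) auto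
    qed
    show "\<Inter> {J. P J \<and> I \<subseteq> J} \<subseteq> qradical I"
      unfolding qradical_eq_Inter_vanishing
    proof (rule INT_greatest)
      fix a assume "a \<in> zero_locus I"
      then show "\<Inter> {J. P J \<and> I \<subseteq> J} \<subseteq> {g. qeval g a = 0}"
        using that(2) point by (intro Inter_lower) simp
    qed
  qed
  show "qradical I = \<Inter> {J. completely_prime_left_ideal J \<and> I \<subseteq> J}"
    using completely_prime_imp_semiprime maximal_imp_completely_prime by (rule Inter)
  show "qradical I = \<Inter> {J. prime_left_ideal J \<and> I \<subseteq> J}"
    using prime_semiprime maximal_imp_prime by (rule Inter)
  show "semiprime_left_ideal (qradical I)"
    unfolding semiprime_left_ideal_def
  proof (intro conjI allI impI)
    show "left_ideal (qradical I)" by (rule left_ideal_qradical)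
    fix f assume f: "{f * r * f | r. True} \<subseteq> qradical I"
    have "f \<in> {g. qeval g a = 0}" if "a \<in> zero_locus I" for a
    proof -
      have "{f * r * f | r. True} \<subseteq> {g. qeval g a = 0}"
        using f that unfolding qradical_eq_Inter_vanishing by blast
      then show ?thesis
        using prime_semiprime[OF maximal_imp_prime[OF point(1)[OF that]]]
        unfolding semiprime_left_ideal_def by blast
    qed
    then show "f \<in> qradical I" unfolding qradical_eq_Inter_vanishing by blast
  qed
  show "I \<subseteq> qradical I" by (rule subset_qradical)
  show "qradical I \<subseteq> J" if "semiprime_left_ideal J \<and> I \<subseteq> J" for J
    using that qradical_subset_semiprime by blast
qed

end
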